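(* Let $\alpha,\eta>0$ and let $x=\eta\rho^{-\alpha}$. Then, as $\rho\to0^+$, $H(x,\rho)=M+R$, where the main term $M$ is $$M=\begin{cases} \dfrac{\Gamma\left(\frac13\right)}{3\pi\rho^2}\cos\left(\pi\left(x-\frac16\right)\right)\left(\dfrac6x\right)^{1/3}, & \alpha>3,\\[2mm] \dfrac{C(\eta)}{\pi\rho}\cos\big(\pi(x-\psi(\eta))\big), & \alpha=3,\\[2mm] \dfrac1{2\rho}\cos(\pi x), & 1<\alpha<3,\\[2mm] \dfrac{e^{-2\eta}+\cos(\pi x)}{2\rho}, & \alpha=1,\\[2mm] \dfrac{1+\cos(\pi x)}{2\rho}, & 0<\alpha<1, \end{cases}$$ and the remainder satisfies $R=o(\rho^{-2}x^{-1/3})$ if $\alpha>3$ and $R=o(\rho^{-1})$ if $0<\alpha\le3$.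
   Context: The restricted Good function is defined for $x\in\mathbb R$ and $\rho>0$ by $$H(x,\rho):=\frac1\pi\int_0^\pi\frac{\cos\big(x(\theta+\sin\theta)\big)}{\rho^2+\sin^2\theta}\,d\theta .$$ For $\lambda>0$, $C(\lambda)\ge0$ and $\psi(\lambda)\in\mathbb R$ are the modulus and the phase (divided by $\pi$) defined by $\int_0^\infty\frac{e^{i\lambda t^3/6}}{1+t^2}\,dt=C(\lambda)e^{i\pi\psi(\lambda)}$. *)

theory Defs
  imports "HOL-Analysis.Analysis" "HOL-Library.Landau_Symbols"
begin

definition restricted_Good :: "real \<Rightarrow> real \<Rightarrow> real" where
  "restricted_Good x \<rho> =
     1 / pi * integral {0..pi} (\<lambda>\<theta>. cos (x * (\<theta> + sin \<theta>)) / (\<rho>\<^sup>2 + (sin \<theta>)\<^sup>2))"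

(* The phase is determined only modulo 2 (and is arbitrary wherever the integral vanishes), so
   modulus and phase are characterised by a predicate instead of fixing a branch of the argument. *)
definition modulus_and_phase :: "(real \<Rightarrow> real) \<Rightarrow> (real \<Rightarrow> real) \<Rightarrow> bool" where
  "modulus_and_phase C \<psi> \<longleftrightarrow>
     (\<forall>l>0. C l \<ge> 0 \<and>
        integral {0..} (\<lambda>t::real. exp (\<i> * complex_of_real (l * t ^ 3 / 6)) / complex_of_real (1 + t\<^sup>2))
          = complex_of_real (C l) * exp (\<i> * complex_of_real (pi * \<psi> l)))"

definition main_term ::
  "(real \<Rightarrow> real) \<Rightarrow> (real \<Rightarrow> real) \<Rightarrow> real \<Rightarrow> real \<Rightarrow> real \<Rightarrow> real \<Rightarrow> real" where
  "main_term C \<psi> \<alpha> \<eta> x \<rho> =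
     (if \<alpha> > 3 then Gamma (1 / 3) / (3 * pi * \<rho>\<^sup>2) * cos (pi * (x - 1 / 6)) * (6 / x) powr (1 / 3)
      else if \<alpha> = 3 then C \<eta> / (pi * \<rho>) * cos (pi * (x - \<psi> \<eta>))
      else if \<alpha> > 1 then 1 / (2 * \<rho>) * cos (pi * x)
      else if \<alpha> = 1 then (exp (- 2 * \<eta>) + cos (pi * x)) / (2 * \<rho>)
      else (1 + cos (pi * x)) / (2 * \<rho>))"

end

theory Submission
  imports Defs "HOL-Complex_Analysis.Complex_Analysis" "HOL-Real_Asymp.Real_Asymp"
begin

text \<open>
  Cut the integral at the midpoint of the interval. Near \<open>\<theta> = 0\<close> the phase \<open>x (\<theta> + sin \<theta>)\<close> has no
  stationary point; near \<open>\<theta> = \<pi>\<close>, with \<open>u = \<pi> - \<theta>\<close>, it is \<open>\<pi> x - x (u - sin u)\<close> and degenerates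
  like \<open>x u\<^sup>3 / 6\<close>. The denominator localises both pieces to the scale \<open>\<rho>\<close>. When the phase varies
  at most on that scale (\<open>\<alpha> \<le> 1\<close> at \<open>0\<close>, \<open>\<alpha> \<le> 3\<close> at \<open>\<pi>\<close>), rescaling by \<open>\<rho>\<close> and dominated
  convergence give the limit; the value for \<open>\<alpha> = 1\<close> is the classical integral of
  \<open>cos (c t) / (1 + t\<^sup>2)\<close>. When it varies faster, a van der Corput estimate makes the piece at \<open>0\<close>
  negligible, and at \<open>\<pi>\<close> the scale \<open>x powr (-1/3)\<close> is the relevant one: there the denominator
  is constant to leading order and a cubic Fresnel integral remains, the rest being controlled by
  van der Corput again.
\<close>

subsection \<open>Oscillatory integrals with monotone amplitude\<close>

text \<open>By the second mean value theorem the integral equals g(a) times one partial integral of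
  f plus g(b) times another, so only the partial integrals of f enter and its cancellation survives.
  The decreasing case applies this to -g.\<close>

lemma abs_integral_monotone_mult_le:
  fixes f g :: "real \<Rightarrow> real"
  assumes f: "f integrable_on {a..b}" and ab: "a \<le> b"
    and mono: "mono_on {a..b} g \<or> antimono_on {a..b} g"
    and G: "\<And>t. t \<in> {a..b} \<Longrightarrow> \<bar>g t\<bar> \<le> G"
    and S: "\<And>c d. a \<le> c \<Longrightarrow> c \<le> d \<Longrightarrow> d \<le> b \<Longrightarrow> \<bar>integral {c..d} f\<bar> \<le> S"
  shows "\<bar>integral {a..b} (\<lambda>t. g t * f t)\<bar> \<le> 2 * G * S"
proof -
  have *: "\<bar>integral {a..b} (\<lambda>t. h t * f t)\<bar> \<le> 2 * G * S"
    if h: "\<And>s t. a \<le> s \<Longrightarrow> s \<le> t \<Longrightarrow> t \<le> b \<Longrightarrow> h s \<le> h t"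
      and hG: "\<And>t. t \<in> {a..b} \<Longrightarrow> \<bar>h t\<bar> \<le> G" for h
  proof -
    obtain c where c: "c \<in> {a..b}"
      and eq: "integral {a..b} (\<lambda>t. h t * f t) = h a * integral {a..c} f + h b * integral {c..b} f"
      using second_mean_value_theorem[where g = h, OF f ab h] by blast
    have "\<bar>h a * integral {a..c} f\<bar> \<le> G * S" "\<bar>h b * integral {c..b} f\<bar> \<le> G * S"
      unfolding abs_mult using c hG[of a] hG[of b] ab
      by (intro mult_mono S; force)+
    then show ?thesis unfolding eq by linarith
  qed
  from mono show ?thesis
  proof
    assume "mono_on {a..b} g"
    then show ?thesis by (intro *) (auto simp: mono_on_def G)
  next
    assume "antimono_on {a..b} g"
    then have "\<bar>integral {a..b} (\<lambda>t. - g t * f t)\<bar> \<le> 2 * G * S"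
      by (intro *) (auto simp: monotone_on_def G)
    then show ?thesis by simp
  qed
qed

text \<open>Van der Corput's first-derivative test. The constant is 2 * 2: the sine primitive varies
  by at most 2, and the mean value bound doubles it.\<close>

lemma abs_integral_cos_le:
  fixes \<phi> \<phi>' :: "real \<Rightarrow> real"
  assumes ab: "a \<le> b" and m: "m > 0"
    and d: "\<And>t. t \<in> {a..b} \<Longrightarrow> (\<phi> has_real_derivative \<phi>' t) (at t within {a..b})"
    and ge: "\<And>t. t \<in> {a..b} \<Longrightarrow> m \<le> \<phi>' t"
    and mono: "mono_on {a..b} \<phi>' \<or> antimono_on {a..b} \<phi>'"
  shows "\<bar>integral {a..b} (\<lambda>t. cos (\<phi> t))\<bar> \<le> 4 / m"
proof -
  have hi: "((\<lambda>t. \<phi>' t * cos (\<phi> t)) has_integral (sin (\<phi> v) - sin (\<phi> u))) {u..v}"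
    if "a \<le> u" "u \<le> v" "v \<le> b" for u v
  proof (rule fundamental_theorem_of_calculus[OF \<open>u \<le> v\<close>])
    fix t assume t: "t \<in> {u..v}"
    have "(\<phi> has_real_derivative \<phi>' t) (at t within {u..v})"
      by (rule DERIV_subset[OF d]) (use t that in auto)
    then show "((\<lambda>t. sin (\<phi> t)) has_vector_derivative \<phi>' t * cos (\<phi> t)) (at t within {u..v})"
      unfolding has_real_derivative_iff_has_vector_derivative [symmetric]
      by (auto intro!: derivative_eq_intros)
  qed
  \<comment> \<open>\<open>cos (\<phi> t)\<close> is the monotone \<open>1 / \<phi>'\<close> times a function with the bounded primitive \<open>sin (\<phi> t)\<close>.\<close>
  have "\<bar>integral {a..b} (\<lambda>t. inverse (\<phi>' t) * (\<phi>' t * cos (\<phi> t)))\<bar> \<le> 2 * (1 / m) * 2"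
  proof (rule abs_integral_monotone_mult_le[OF _ ab])
    show "(\<lambda>t. \<phi>' t * cos (\<phi> t)) integrable_on {a..b}"
      using hi[of a b] ab by (auto simp: integrable_on_def)
    have pos: "\<phi>' t > 0" if "t \<in> {a..b}" for t
      using ge[OF that] m by linarith
    show "mono_on {a..b} (\<lambda>t. inverse (\<phi>' t)) \<or> antimono_on {a..b} (\<lambda>t. inverse (\<phi>' t))"
      using mono
      by (elim disjE) (auto simp: monotone_on_def intro!: le_imp_inverse_le pos)
    show "\<bar>inverse (\<phi>' t)\<bar> \<le> 1 / m" if "t \<in> {a..b}" for t
      using ge[OF that] pos[OF that] m by (simp add: field_simps)
    fix u v assume "a \<le> u" "u \<le> v" "v \<le> b"
    then have "integral {u..v} (\<lambda>t. \<phi>' t * cos (\<phi> t)) = sin (\<phi> v) - sin (\<phi> u)"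
      using hi by blast
    then show "\<bar>integral {u..v} (\<lambda>t. \<phi>' t * cos (\<phi> t))\<bar> \<le> 2"
      using abs_sin_le_one[of "\<phi> u"] abs_sin_le_one[of "\<phi> v"] by linarith
  qed
  also have "integral {a..b} (\<lambda>t. inverse (\<phi>' t) * (\<phi>' t * cos (\<phi> t))) = integral {a..b} (\<lambda>t. cos (\<phi> t))"
    by (rule integral_cong) (use ge m in force)
  finally show ?thesis by simp
qed

text \<open>A second use of the mean value bound: the first-derivative test holds on every
  subinterval with the same 4 / m, so a monotone amplitude costs only a factor 2 G.\<close>

lemma abs_integral_monotone_cos_le:
  fixes g \<phi> \<phi>' :: "real \<Rightarrow> real"
  assumes ab: "a \<le> b" and m: "m > 0"
    and d: "\<And>t. t \<in> {a..b} \<Longrightarrow> (\<phi> has_real_derivative \<phi>' t) (at t within {a..b})"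
    and ge: "\<And>t. t \<in> {a..b} \<Longrightarrow> m \<le> \<phi>' t"
    and mono: "mono_on {a..b} \<phi>' \<or> antimono_on {a..b} \<phi>'"
    and gmono: "mono_on {a..b} g \<or> antimono_on {a..b} g"
    and G: "\<And>t. t \<in> {a..b} \<Longrightarrow> \<bar>g t\<bar> \<le> G"
  shows "\<bar>integral {a..b} (\<lambda>t. g t * cos (\<phi> t))\<bar> \<le> 8 * G / m"
proof -
  have "continuous_on {a..b} \<phi>" by (rule DERIV_continuous_on[OF d])
  then have i: "(\<lambda>t. cos (\<phi> t)) integrable_on {a..b}"
    by (intro integrable_continuous_real continuous_intros)
  have "\<bar>integral {a..b} (\<lambda>t. g t * cos (\<phi> t))\<bar> \<le> 2 * G * (4 / m)"
  proof (rule abs_integral_monotone_mult_le[OF i ab gmono G])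
    fix u v assume uv: "a \<le> u" "u \<le> v" "v \<le> b"
    then have sub: "{u..v} \<subseteq> {a..b}" by auto
    show "\<bar>integral {u..v} (\<lambda>t. cos (\<phi> t))\<bar> \<le> 4 / m"
      by (rule abs_integral_cos_le[of u v m \<phi> \<phi>'])
        (use sub uv m mono ge in \<open>auto intro: DERIV_subset[OF d] mono_on_subset monotone_on_subset\<close>)
  qed auto
  then show ?thesis by simp
qed

text \<open>Real and imaginary parts are bounded separately. Since sin \<phi> = cos (\<phi> - pi /
  2), the imaginary part is the same estimate with a shifted phase, and 8 + 8 gives 16.\<close>

lemma norm_integral_monotone_exp_le:
  fixes g \<phi> \<phi>' :: "real \<Rightarrow> real"
  assumes ab: "a \<le> b" and m: "m > 0"
    and d: "\<And>t. t \<in> {a..b} \<Longrightarrow> (\<phi> has_real_derivative \<phi>' t) (at t within {a..b})"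
    and ge: "\<And>t. t \<in> {a..b} \<Longrightarrow> m \<le> \<phi>' t"
    and mono: "mono_on {a..b} \<phi>' \<or> antimono_on {a..b} \<phi>'"
    and gmono: "mono_on {a..b} g \<or> antimono_on {a..b} g"
    and G: "\<And>t. t \<in> {a..b} \<Longrightarrow> \<bar>g t\<bar> \<le> G"
    and g: "continuous_on {a..b} g"
  shows "norm (integral {a..b} (\<lambda>t. of_real (g t) * exp (\<i> * of_real (\<phi> t)))) \<le> 16 * G / m"
    (is "norm (integral _ ?f) \<le> _")
proof -
  have "continuous_on {a..b} \<phi>" by (rule DERIV_continuous_on[OF d])
  then have i: "?f integrable_on {a..b}"
    by (intro integrable_continuous_real continuous_intros g)
  have "Re (integral {a..b} ?f) = integral {a..b} (\<lambda>t. g t * cos (\<phi> t))"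
    using integral_linear[OF i bounded_linear_Re]
    by (simp add: o_def Re_exp)
  moreover have "Im (integral {a..b} ?f) = integral {a..b} (\<lambda>t. g t * cos (\<phi> t - pi / 2))"
    using integral_linear[OF i bounded_linear_Im]
    by (simp add: o_def Im_exp cos_diff)
  moreover have "\<bar>integral {a..b} (\<lambda>t. g t * cos (\<phi> t))\<bar> \<le> 8 * G / m"
    by (rule abs_integral_monotone_cos_le[OF ab m d ge mono gmono G])
  moreover have "\<bar>integral {a..b} (\<lambda>t. g t * cos (\<phi> t - pi / 2))\<bar> \<le> 8 * G / m"
    by (rule abs_integral_monotone_cos_le[OF ab m _ ge mono gmono G])
      (auto intro!: derivative_eq_intros d)
  ultimately show ?thesis
    using cmod_le[of "integral {a..b} ?f"] by linarith
qed

subsection \<open>Integrals over the half-line\<close>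

text \<open>Dominated convergence for the truncations of f to [0, n], extended by zero. It turns a
  limit of proper integrals into the value of the half-line integral.\<close>

lemma has_integral_atLeast_0I:
  fixes f :: "real \<Rightarrow> 'a::euclidean_space"
  assumes f: "\<And>b. f integrable_on {0..b}" and h: "h integrable_on {0..}"
    and le: "\<And>t. t \<ge> 0 \<Longrightarrow> norm (f t) \<le> h t"
    and lim: "(\<lambda>n. integral {0..real n} f) \<longlonglongrightarrow> L"
  shows "(f has_integral L) {0..}"
proof (rule has_integral_dominated_convergence[OF _ h])
  show "((\<lambda>t. if t \<in> {0..real n} then f t else 0) has_integral integral {0..real n} f) {0..}" for n
    by (subst has_integral_restrict) (auto intro: f)
  show "\<forall>t\<in>{0..}. norm (if t \<in> {0..real n} then f t else 0) \<le> h t" for n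
    using le order_trans[OF norm_ge_zero le] by auto
  show "\<forall>t\<in>{0..}. (\<lambda>n. if t \<in> {0..real n} then f t else 0) \<longlonglongrightarrow> f t"
  proof
    fix t :: real assume "t \<in> {0..}"
    moreover have "\<forall>\<^sub>F n in sequentially. t \<le> real n"
      using filterlim_real_sequentially by (simp add: filterlim_at_top)
    ultimately show "(\<lambda>n. if t \<in> {0..real n} then f t else 0) \<longlonglongrightarrow> f t"
      by (intro tendsto_eventually) (elim eventually_mono, simp)
  qed
qed (rule lim)

text \<open>The opposite direction, for a real upper limit: the truncations are tested along an
  arbitrary sequence tending to infinity.\<close>

lemma tendsto_integral_atLeastAtMost_0:
  fixes f :: "real \<Rightarrow> 'a::euclidean_space"
  assumes f: "\<And>b. f integrable_on {0..b}" and h: "h integrable_on {0..}"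
    and le: "\<And>t. t \<ge> 0 \<Longrightarrow> norm (f t) \<le> h t"
  shows "((\<lambda>b. integral {0..b} f) \<longlongrightarrow> integral {0..} f) at_top"
proof (rule tendsto_at_topI_sequentially)
  fix X :: "nat \<Rightarrow> real" assume X: "filterlim X at_top sequentially"
  have "(\<lambda>n. integral {0..} (\<lambda>t. if t \<in> {0..X n} then f t else 0)) \<longlonglongrightarrow> integral {0..} f"
  proof (rule dominated_convergence(2)[OF _ h])
    show "(\<lambda>t. if t \<in> {0..X n} then f t else 0) integrable_on {0..}" for n
      using has_integral_restrict[of "{0..X n}" "{0..}" f] f[of "X n"]
      by (auto simp: integrable_on_def)
    show "norm (if t \<in> {0..X n} then f t else 0) \<le> h t" if "t \<in> {0..}" for n t
      using le[of t] order_trans[OF norm_ge_zero le, of t] that by auto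
    fix t :: real assume "t \<in> {0..}"
    moreover have "\<forall>\<^sub>F n in sequentially. t \<le> X n"
      using X by (simp add: filterlim_at_top)
    ultimately show "(\<lambda>n. if t \<in> {0..X n} then f t else 0) \<longlonglongrightarrow> f t"
      by (intro tendsto_eventually) (elim eventually_mono, simp)
  qed
  moreover have "integral {0..} (\<lambda>t. if t \<in> {0..X n} then f t else 0) = integral {0..X n} f" for n
    by (simp add: integral_restrict_Int Int_absorb2 del: atLeastAtMost_iff)
  ultimately show "(\<lambda>n. integral {0..X n} f) \<longlonglongrightarrow> integral {0..} f"
    by simp
qed

text \<open>Integrability comes first, from monotone convergence with the arctan values bounded by
  pi / 2. The integrand can then dominate itself, and the limit of arctan gives the value. It is
  also the majorant for the later limits on the half-line.\<close>

lemma has_integral_inverse_1_plus_square: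
  "((\<lambda>t::real. 1 / (1 + t\<^sup>2)) has_integral pi / 2) {0..}"
proof -
  have i: "((\<lambda>t::real. 1 / (1 + t\<^sup>2)) has_integral arctan (real n)) {0..real n}" for n
  proof -
    have "((\<lambda>t::real. 1 / (1 + t\<^sup>2)) has_integral (arctan (real n) - arctan 0)) {0..real n}"
      by (rule fundamental_theorem_of_calculus)
        (auto simp: has_real_derivative_iff_has_vector_derivative [symmetric] inverse_eq_divide
          intro!: derivative_eq_intros)
    then show ?thesis by simp
  qed
  let ?f = "\<lambda>n t. if t \<in> {0..real n} then 1 / (1 + t\<^sup>2) else 0 :: real"
  have "(\<lambda>t::real. 1 / (1 + t\<^sup>2)) integrable_on {0..} \<and>
    (\<lambda>n. integral {0..} (?f n)) \<longlonglongrightarrow> integral {0..} (\<lambda>t::real. 1 / (1 + t\<^sup>2))"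
  proof (rule monotone_convergence_increasing)
    have *: "(?f n has_integral arctan (real n)) {0..}" for n
      using i by (subst has_integral_restrict) auto
    then show "?f n integrable_on {0..}" for n by (auto simp: integrable_on_def)
    have "norm (integral {0..} (?f n)) \<le> pi / 2" for n
      using arctan_bounded[of "real n"] by (simp only: integral_unique[OF *]) auto
    then show "bounded (range (\<lambda>n. integral {0..} (?f n)))"
      unfolding bounded_iff by blast
    fix t :: real assume t: "t \<in> {0..}"
    show "?f n t \<le> ?f (Suc n) t" for n by auto
    have "\<forall>\<^sub>F n in sequentially. t \<le> real n"
      using filterlim_real_sequentially by (simp add: filterlim_at_top)
    with t show "(\<lambda>n. ?f n t) \<longlonglongrightarrow> 1 / (1 + t\<^sup>2)"
      by (intro tendsto_eventually) (elim eventually_mono, simp)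
  qed
  then have int: "(\<lambda>t::real. 1 / (1 + t\<^sup>2)) integrable_on {0..}" by blast
  have "(\<lambda>n. arctan (real n)) \<longlonglongrightarrow> pi / 2"
    using tendsto_arctan_at_top filterlim_real_sequentially by (rule filterlim_compose)
  then show ?thesis
    by (intro has_integral_atLeast_0I[OF integrable_on_subinterval[OF int] int])
      (auto simp: integral_unique[OF i])
qed

subsection \<open>Two contour integrals\<close>

text \<open>The fundamental theorem along a path. Contour deformation thereby reduces to comparing
  values of one primitive at common endpoints.\<close>

lemma has_integral_primitive_along_path:
  fixes F f :: "complex \<Rightarrow> complex"
  assumes F: "\<And>z. z \<in> S \<Longrightarrow> (F has_field_derivative f z) (at z within S)"
    and "a \<le> b" and p: "\<And>t. t \<in> {a..b} \<Longrightarrow> (p has_vector_derivative p' t) (at t within {a..b})"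
    and sub: "p ` {a..b} \<subseteq> S"
  shows "((\<lambda>t. p' t * f (p t)) has_integral (F (p b) - F (p a))) {a..b}"
proof (rule fundamental_theorem_of_calculus[OF \<open>a \<le> b\<close>, of "\<lambda>t. F (p t)"])
  fix t assume t: "t \<in> {a..b}"
  show "((\<lambda>t. F (p t)) has_vector_derivative p' t * f (p t)) (at t within {a..b})"
    using field_vector_diff_chain_within[OF p[OF t], of F "f (p t)"]
      DERIV_subset[OF F[of "p t"] sub] t sub by (force simp: o_def)
qed

text \<open>With exp (- c) subtracted from the cosine, the integral over [-r, r] equals in absolute
  value the real part of one over the upper semicircle, which is O(1/r). So the difference
  integrates to 0, leaving exp (- c) times the arctan integral.\<close>

lemma has_integral_cos_over_1_plus_square:
  fixes c :: real
  assumes c: "c \<ge> 0"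
  shows "((\<lambda>t. cos (c * t) / (1 + t\<^sup>2)) has_integral pi / 2 * exp (- c)) {0..}"
proof -
  define h where "h z = exp (\<i> * of_real c * z)" for z :: complex
  \<comment> \<open>Subtracting \<open>h \<i>\<close> makes the pole at \<open>\<i>\<close> removable, so \<open>g\<close> has a primitive on a half-plane.\<close>
  define g where "g z = (if z = \<i> then deriv h \<i> / (2 * \<i>) else (h z - exp (- of_real c)) / (1 + z\<^sup>2))" for z
  \<comment> \<open>This half-plane is convex, contains the closed upper half-plane in which the
    contours lie, and excludes the other pole -\<i>.\<close>
  define S where "S = {z. Im z > - 1 / 2}"
  have hi: "h \<i> = exp (- of_real c)" by (simp add: h_def algebra_simps)
  have convex: "convex S" unfolding S_def by (rule convex_halfspace_Im_gt)
  have "open S" unfolding S_def by (rule open_halfspace_Im_gt)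
  have nz: "1 + z\<^sup>2 \<noteq> 0" if "z \<in> S - {\<i>}" for z
  proof
    assume "1 + z\<^sup>2 = 0"
    then have "(z - \<i>) * (z + \<i>) = 0" by (simp add: algebra_simps power2_eq_square)
    with that show False by (auto simp: S_def add_eq_0_iff2)
  qed
  have hol: "g holomorphic_on S - {\<i>}"
  proof (rule holomorphic_transform)
    show "(\<lambda>z. (h z - exp (- of_real c)) / (1 + z\<^sup>2)) holomorphic_on S - {\<i>}"
      unfolding h_def using nz by (intro holomorphic_intros) auto
  qed (simp add: g_def)
  have "h field_differentiable at \<i>"
    unfolding h_def field_differentiable_def by (auto intro!: exI derivative_eq_intros)
  then have "((\<lambda>z. (h z - h \<i>) / (z - \<i>)) \<longlongrightarrow> deriv h \<i>) (at \<i>)"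
    using DERIV_deriv_iff_field_differentiable has_field_derivative_iff by blast
  \<comment> \<open>As 1 + z^2 = (z - \<i>)(z + \<i>), the limit at \<i> is the derivative of
    \<open>h\<close> over 2 \<i>, which is the value assigned to \<open>g\<close> there.\<close>
  then have "((\<lambda>z. (h z - h \<i>) / (z - \<i>) / (z + \<i>)) \<longlongrightarrow> deriv h \<i> / (\<i> + \<i>)) (at \<i>)"
    by (intro tendsto_intros) auto
  then have "((\<lambda>z. (h z - h \<i>) / (z - \<i>) / (z + \<i>)) \<longlongrightarrow> g \<i>) (at \<i>)"
    by (simp add: g_def)
  then have "(g \<longlongrightarrow> g \<i>) (at \<i>)"
    by (rule Lim_transform_eventually)
      (auto simp: eventually_at_filter g_def hi algebra_simps power2_eq_square)
  then have "isCont g \<i>" by (simp add: isCont_def)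
  moreover have "isCont g z" if "z \<in> S - {\<i>}" for z
    using hol that \<open>open S\<close>
    by (meson continuous_on_eq_continuous_at holomorphic_on_imp_continuous_on open_delete)
  ultimately have "continuous_on S g"
    by (metis DiffI continuous_at_imp_continuous_on singletonD)
  \<comment> \<open>On a convex set, continuity at the single exceptional point \<i> is enough for a
    primitive.\<close>
  obtain G where G: "\<And>z. z \<in> S \<Longrightarrow> (G has_field_derivative g z) (at z within S)"
    using holomorphic_convex_primitive[of S "{\<i>}" g] convex \<open>continuous_on S g\<close> hol \<open>open S\<close>
    by (metis finite.emptyI finite.insertI holomorphic_on_imp_differentiable_at interior_open open_delete)
  define f where "f t = (cos (c * t) - exp (- c)) / (1 + t\<^sup>2)" for t
  have cont: "continuous_on A f" for A
    unfolding f_def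
    by (intro continuous_intros) (metis add_pos_nonneg less_numeral_extra(1,3) zero_le_power2)
  \<comment> \<open>\<open>f\<close> is the real part of \<open>g\<close> on the real axis and is
    even, hence the factor 2.\<close>
  have real_line: "Re (G (of_real r) - G (- of_real r)) = 2 * integral {0..r} f" if r: "r \<ge> 0" for r
  proof -
    have "((\<lambda>t. 1 * g (of_real t)) has_integral (G (of_real r) - G (of_real (- r)))) {- r..r}"
      by (rule has_integral_primitive_along_path[OF G])
        (use r in \<open>auto simp: S_def intro!: derivative_eq_intros\<close>)
    from has_integral_linear[OF this bounded_linear_Re]
    have "((\<lambda>t. Re (g (of_real t))) has_integral Re (G (of_real r) - G (- of_real r))) {- r..r}"
      by (simp add: o_def)
    moreover have "Re (g (of_real t)) = f t" for t
    proof -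
      have "complex_of_real t \<noteq> \<i>" by (simp add: complex_eq_iff)
      moreover have "1 + (complex_of_real t)\<^sup>2 = of_real (1 + t\<^sup>2)" by simp
      ultimately have "Re (g (of_real t)) = Re (h (of_real t) - of_real (exp (- c))) / (1 + t\<^sup>2)"
        unfolding g_def by (simp only: if_False Re_divide_of_real) (simp flip: exp_of_real)
      then show ?thesis by (simp add: h_def f_def Re_exp)
    qed
    ultimately have "(f has_integral Re (G (of_real r) - G (- of_real r))) {- r..r}" by simp
    moreover have "(f has_integral (integral {0..r} f + integral {0..r} f)) {- r..r}"
    proof (rule has_integral_combine[of "- r" 0 r])
      have fi: "(f has_integral integral {0..r} f) {0..r}"
        by (intro integrable_integral integrable_continuous_real cont)
      then show "(f has_integral integral {0..r} f) {0..r}" .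
      have "((\<lambda>t. f (- t)) has_integral integral {0..r} f) {- r..- 0}"
        using fi by (simp only: has_integral_reflect_real)
      moreover have "(\<lambda>t. f (- t)) = f" by (simp add: f_def fun_eq_iff)
      ultimately show "(f has_integral integral {0..r} f) {- r..0}" by simp
    qed (use r in auto)
    ultimately have "Re (G (of_real r) - G (- of_real r)) = integral {0..r} f + integral {0..r} f"
      by (rule has_integral_unique)
    then show ?thesis by simp
  qed
  \<comment> \<open>On the upper semicircle |h| \<le> 1 because c \<ge> 0 and Im z \<ge> 0. So the
    numerator is at most 2, the denominator at least r^2 - 1, and the length is pi r.\<close>
  have arc: "norm (G (of_real r) - G (- of_real r)) \<le> r * (2 / (r\<^sup>2 - 1)) * pi" if r: "r > 1" for r
  proof -
    define p where "p t = complex_of_real r * exp (\<i> * of_real t)" for t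
    have r2: "r\<^sup>2 > 1" using r by (simp add: one_less_power)
    have Imp: "Im (p t) \<ge> 0" if "t \<in> {0..pi}" for t
      using that r by (auto simp: p_def Im_exp sin_ge_zero)
    have np: "norm (p t) = r" for t
      using r by (simp add: p_def norm_mult)
    have "((\<lambda>t. \<i> * p t * g (p t)) has_integral (G (p pi) - G (p 0))) {0..pi}"
    proof (rule has_integral_primitive_along_path[OF G])
      show "p ` {0..pi} \<subseteq> S" using Imp by (force simp: S_def)
      show "(p has_vector_derivative \<i> * p t) (at t within {0..pi})" for t
        unfolding p_def by (rule has_vector_derivative_real_field) (auto intro!: derivative_eq_intros)
    qed auto
    then have "norm (G (p pi) - G (p 0)) \<le> r * (2 / (r\<^sup>2 - 1)) * Henstock_Kurzweil_Integration.content {0..pi}"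
    proof (rule has_integral_bound_real[rotated 2])
      show "norm (\<i> * p t * g (p t)) \<le> r * (2 / (r\<^sup>2 - 1))" if t: "t \<in> {0..pi} - {}" for t
      proof -
        have "norm (h (p t)) \<le> 1"
          using Imp[of t] t c by (simp add: h_def)
        moreover have "norm (exp (- complex_of_real c)) \<le> 1" using c by simp
        ultimately have 1: "norm (h (p t) - exp (- complex_of_real c)) \<le> 2"
          using norm_triangle_ineq4[of "h (p t)" "exp (- complex_of_real c)"] by linarith
        have "r\<^sup>2 - 1 \<le> norm (1 + (p t)\<^sup>2)"
          using norm_diff_ineq[of "(p t)\<^sup>2" 1] np[of t] by (simp add: norm_power add.commute)
        then have "norm ((h (p t) - exp (- complex_of_real c)) / (1 + (p t)\<^sup>2)) \<le> 2 / (r\<^sup>2 - 1)"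
          unfolding norm_divide using 1 r2 by (intro frac_le) auto
        moreover have "p t \<noteq> \<i>" using np[of t] r by auto
        ultimately have "norm (g (p t)) \<le> 2 / (r\<^sup>2 - 1)" by (simp add: g_def)
        then show "norm (\<i> * p t * g (p t)) \<le> r * (2 / (r\<^sup>2 - 1))"
          unfolding norm_mult np using r by (auto intro: mult_left_mono simp del: times_divide_eq_right)
      qed
    qed (use r r2 in auto)
    moreover have "p pi = - of_real r" "p 0 = of_real r" by (simp_all add: p_def)
    ultimately show ?thesis by (simp add: norm_minus_commute)
  qed
  have "(\<lambda>n. integral {0..real n} f) \<longlonglongrightarrow> 0"
  proof (rule Lim_null_comparison)
    show "\<forall>\<^sub>F n in sequentially. norm (integral {0..real n} f) \<le> real n * (2 / ((real n)\<^sup>2 - 1)) * pi"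
      using eventually_ge_at_top[of 2]
    proof eventually_elim
      case (elim n)
      have "\<bar>2 * integral {0..real n} f\<bar> \<le> norm (G (of_real (real n)) - G (- of_real (real n)))"
        unfolding real_line[OF of_nat_0_le_iff, symmetric] by (rule abs_Re_le_cmod)
      also have "\<dots> \<le> real n * (2 / ((real n)\<^sup>2 - 1)) * pi" by (rule arc) (use elim in simp)
      finally show ?case by simp
    qed
    show "(\<lambda>n. real n * (2 / ((real n)\<^sup>2 - 1)) * pi) \<longlonglongrightarrow> 0" by real_asymp
  qed
  then have "(f has_integral 0) {0..}"
  proof (rule has_integral_atLeast_0I[rotated 3])
    show "f integrable_on {0..b}" for b by (intro integrable_continuous_real cont)
    show "(\<lambda>t. 2 * (1 / (1 + t\<^sup>2)) :: real) integrable_on {0..}"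
      using has_integral_mult_right[OF has_integral_inverse_1_plus_square, of 2]
      by (auto simp: integrable_on_def)
    fix t :: real
    have "\<bar>cos (c * t)\<bar> \<le> 1" "0 \<le> exp (- c)" "exp (- c) \<le> 1" using c by auto
    then have "\<bar>cos (c * t) - exp (- c)\<bar> \<le> 2" by linarith
    moreover have "1 + t\<^sup>2 > 0" by (simp add: add_pos_nonneg)
    ultimately show "norm (f t) \<le> 2 * (1 / (1 + t\<^sup>2))"
      by (simp add: f_def divide_right_mono)
  qed
  from has_integral_add[OF this has_integral_mult_right[OF has_integral_inverse_1_plus_square, of "exp (- c)"]]
  show ?thesis by (simp add: f_def diff_divide_distrib mult.commute)
qed

text \<open>Integration by parts gives b exp(-b^3) plus the integral of 3 t^3 exp(-t^3). The
  substitution s = t^3 turns the latter into a truncated integral for Gamma (4/3) = Gamma (1/3) / 3,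
  while the boundary term vanishes in the limit.\<close>

lemma tendsto_integral_exp_minus_cube:
  "((\<lambda>b::real. integral {0..b} (\<lambda>t. exp (- (t ^ 3)))) \<longlongrightarrow> Gamma (1 / 3) / 3) at_top"
proof -
  define f where "f s = s powr (1 / 3) / exp s" for s :: real
  have f: "continuous_on {0..b} f" for b
    unfolding f_def by (intro continuous_intros continuous_on_powr') auto
  have G: "(f has_integral Gamma (4 / 3)) {0..}"
    using Gamma_integral_real[of "4/3"] unfolding f_def by simp
  have "(1 / 3 :: real) \<notin> \<int>\<^sub>\<le>\<^sub>0"
    using nonpos_Ints_nonpos[of "1 / 3 :: real"] by linarith
  then have "Gamma (1 / 3 + 1 :: real) = 1 / 3 * Gamma (1 / 3)"
    by (rule Gamma_plus1)
  then have "Gamma (4 / 3 :: real) = Gamma (1 / 3) / 3" by simp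
  with G have G': "(f has_integral Gamma (1 / 3) / 3) {0..}" by (simp only:)
  have "((\<lambda>b. integral {0..b} f) \<longlongrightarrow> integral {0..} f) at_top"
  proof (rule tendsto_integral_atLeastAtMost_0)
    show "f integrable_on {0..b}" for b by (intro integrable_continuous_real f)
    show "f integrable_on {0..}" using G' by (rule has_integral_integrable)
  qed (simp add: f_def)
  then have lim: "((\<lambda>b. integral {0..b} f) \<longlongrightarrow> Gamma (1 / 3) / 3) at_top"
    using integral_unique[OF G'] by simp
  have eq: "integral {0..b} (\<lambda>t. exp (- (t ^ 3))) = b * exp (- (b ^ 3)) + integral {0..b ^ 3} f" if b: "b \<ge> 0" for b
  proof -
    \<comment> \<open>Substituting in \<open>\<Gamma>(4/3)\<close> rather than \<open>\<Gamma>(1/3)\<close> keeps the integrand continuous at \<open>0\<close>.\<close>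
    have sub: "((\<lambda>t. (3 * t\<^sup>2) *\<^sub>R f (t ^ 3)) has_integral (integral {0 ^ 3..b ^ 3} f)) {0..b}"
      by (rule has_integral_substitution[OF b _ _ f[of "b ^ 3"], where g = "\<lambda>t. t ^ 3"])
        (use b in \<open>auto intro!: derivative_eq_intros power_mono\<close>)
    have "((\<lambda>t. 3 * t ^ 3 * exp (- (t ^ 3))) has_integral (integral {0 ^ 3..b ^ 3} f)) {0..b}"
    proof (rule has_integral_eq[OF _ sub])
      fix t assume t: "t \<in> {0..b}"
      have "(t ^ 3) powr (1 / 3) = t"
      proof (cases "t = 0")
        case False
        with t have "t ^ 3 = t powr 3" by (simp add: powr_numeral)
        with t show ?thesis by (simp only: powr_powr) simp
      qed simp
      then have "f (t ^ 3) = t * exp (- (t ^ 3))" by (simp add: f_def exp_minus field_simps)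
      then show "(3 * t\<^sup>2) *\<^sub>R f (t ^ 3) = 3 * t ^ 3 * exp (- (t ^ 3))"
        by (simp add: power2_eq_square power3_eq_cube)
    qed
    then have 1: "((\<lambda>t. 3 * t ^ 3 * exp (- (t ^ 3))) has_integral (integral {0..b ^ 3} f)) {0..b}"
      by simp
    \<comment> \<open>This integrand is the derivative of t exp(-t^3); adding it to the previous one
      cancels the cubic factor.\<close>
    have 2: "((\<lambda>t. exp (- (t ^ 3)) - 3 * t ^ 3 * exp (- (t ^ 3))) has_integral (b * exp (- (b ^ 3)) - 0 * exp (- (0 ^ 3)))) {0..b}"
      by (rule fundamental_theorem_of_calculus[OF b])
       (auto simp: has_real_derivative_iff_has_vector_derivative [symmetric] power2_eq_square power3_eq_cube
        intro!: derivative_eq_intros)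
    from has_integral_add[OF 1 2] show ?thesis by (simp add: integral_unique)
  qed
  have "((\<lambda>b. b * exp (- (b ^ 3)) + integral {0..b ^ 3} f) \<longlongrightarrow> 0 + Gamma (1 / 3) / 3) at_top"
  proof (rule tendsto_add)
    show "((\<lambda>b::real. b * exp (- (b ^ 3))) \<longlongrightarrow> 0) at_top" by real_asymp
    show "((\<lambda>b. integral {0..b ^ 3} f) \<longlongrightarrow> Gamma (1 / 3) / 3) at_top"
      by (rule filterlim_compose[OF lim]) real_asymp
  qed
  then have "((\<lambda>b. b * exp (- (b ^ 3)) + integral {0..b ^ 3} f) \<longlongrightarrow> Gamma (1 / 3) / 3) at_top"
    by (simp only: add_0)
  then show ?thesis
  proof (rule Lim_transform_eventually)
    show "\<forall>\<^sub>F b in at_top. b * exp (- (b ^ 3)) + integral {0..b ^ 3} f = integral {0..b} (\<lambda>t. exp (- (t ^ 3)))"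
      using eventually_ge_at_top[of 0] by eventually_elim (simp add: eq)
  qed
qed

text \<open>Rotation of the ray by pi / 6: there z^3 = \<i> t^3, so the oscillating exponential
  becomes exp(-t^3). The real segment and the rotated one are joined by a vertical segment whose
  contribution is at most 1 / b^2.\<close>

lemma tendsto_integral_exp_ii_cube:
  "((\<lambda>b::real. integral {0..b} (\<lambda>t. exp (\<i> * of_real (t ^ 3)))) \<longlongrightarrow>
     of_real (Gamma (1 / 3) / 3) * exp (\<i> * of_real (pi / 6))) at_top"
proof -
  define f where "f z = exp (\<i> * z ^ 3)" for z :: complex
  obtain F where F: "\<And>z. (F has_field_derivative f z) (at z within UNIV)"
    using holomorphic_convex_primitive'[of UNIV f] unfolding f_def
    by (force intro!: holomorphic_intros)
  define w where "w = exp (\<i> * complex_of_real (pi / 6))"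
  have w: "w = Complex (sqrt 3 / 2) (1 / 2)"
    by (simp add: w_def complex_eq_iff Re_exp Im_exp cos_30 sin_30)
  have w3: "w ^ 3 = \<i>"
    by (simp add: w complex_eq_iff power3_eq_cube algebra_simps)
  define s where "s = sqrt (3 :: real)"
  have s: "s > 0" "s * s = 3" by (simp_all add: s_def)
  have horizontal: "integral {0..b} (\<lambda>t. exp (\<i> * of_real (t ^ 3))) = F (of_real b) - F 0" if "b \<ge> 0" for b
  proof -
    have "((\<lambda>t. 1 * f (of_real t)) has_integral (F (of_real b) - F (of_real 0))) {0..b}"
      by (rule has_integral_primitive_along_path[OF F]) (use that in \<open>auto intro!: derivative_eq_intros\<close>)
    then show ?thesis by (simp add: f_def integral_unique)
  qed
  have diagonal: "of_real (integral {0..b} (\<lambda>t. exp (- (t ^ 3)))) * w = F (of_real b * w) - F 0" if "b \<ge> 0" for b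
  proof -
    have "((\<lambda>t. w * f (of_real t * w)) has_integral (F (of_real b * w) - F (of_real 0 * w))) {0..b}"
      by (rule has_integral_primitive_along_path[OF F]) (use that in \<open>auto intro!: derivative_eq_intros\<close>)
    moreover have "f (of_real t * w) = of_real (exp (- (t ^ 3)))" for t
      by (simp add: f_def power_mult_distrib w3 exp_of_real[symmetric] mult_ac)
    ultimately have "((\<lambda>t. w * of_real (exp (- (t ^ 3)))) has_integral (F (of_real b * w) - F 0)) {0..b}"
      by simp
    moreover have "((\<lambda>t. w * of_real (exp (- (t ^ 3)))) has_integral
        w * of_real (integral {0..b} (\<lambda>t. exp (- (t ^ 3))))) {0..b}"
      by (intro has_integral_mult_right has_integral_of_real integrable_integral integrable_continuous_real
          continuous_intros)
    ultimately show ?thesis by (metis has_integral_unique mult.commute)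
  qed
  \<comment> \<open>At z = b + \<i> t the real part of \<i> z^3 is t^3 - 3 b^2 t. For t \<le> b /
    sqrt 3 this is at most -b^2 t, and integrating exp(-b^2 t) gives at most 1 / b^2.\<close>
  have vertical: "norm (F (of_real b + \<i> * of_real (b / s)) - F (of_real b)) \<le> 1 / b\<^sup>2" if b: "b > 0" for b
  proof -
    define p where "p t = complex_of_real b + \<i> * of_real t" for t
    have int: "((\<lambda>t. \<i> * f (p t)) has_integral (F (p (b / s)) - F (p 0))) {0..b / s}"
      unfolding p_def
      by (rule has_integral_primitive_along_path[OF F]) (use b s in \<open>auto intro!: derivative_eq_intros\<close>)
    have bound: "norm (\<i> * f (p t)) \<le> exp (- (b\<^sup>2 * t))" if "t \<in> {0..b / s}" for t
    proof -
      have "t * s \<le> b" using that s by (simp add: field_simps)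
      then have "(t * s)\<^sup>2 \<le> b\<^sup>2" using that s by (intro power_mono) auto
      then have "3 * t\<^sup>2 \<le> b\<^sup>2" using s by (simp add: power_mult_distrib power2_eq_square[of s] mult.commute)
      then have "t * (3 * t\<^sup>2) \<le> t * b\<^sup>2" using that by (intro mult_left_mono) auto
      moreover have "0 \<le> t * b\<^sup>2" using that by simp
      moreover have "Re (\<i> * p t ^ 3) = t * t\<^sup>2 - 3 * (t * b\<^sup>2)"
        by (simp add: p_def power3_eq_cube power2_eq_square algebra_simps)
      moreover have "t * (3 * t\<^sup>2) = 3 * (t * t\<^sup>2)" "b\<^sup>2 * t = t * b\<^sup>2" "0 \<le> t * t\<^sup>2"
        using that by simp_all
      ultimately have "Re (\<i> * p t ^ 3) \<le> - (b\<^sup>2 * t)"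
        by linarith
      then show ?thesis by (simp add: f_def norm_mult)
    qed
    have e: "((\<lambda>t. exp (- (b\<^sup>2 * t))) has_integral
        (- exp (- (b\<^sup>2 * (b / s))) / b\<^sup>2 - (- exp (- (b\<^sup>2 * 0)) / b\<^sup>2))) {0..b / s}"
      by (rule fundamental_theorem_of_calculus)
        (use b s in \<open>auto simp: has_real_derivative_iff_has_vector_derivative [symmetric] field_simps power2_eq_square
          intro!: derivative_eq_intros\<close>)
    have "norm (F (p (b / s)) - F (p 0)) \<le> - exp (- (b\<^sup>2 * (b / s))) / b\<^sup>2 - (- exp (- (b\<^sup>2 * 0)) / b\<^sup>2)"
      using integral_norm_bound_integral[of "\<lambda>t. \<i> * f (p t)" "{0..b / s}" "\<lambda>t. exp (- (b\<^sup>2 * t))"]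
        int e bound by (auto simp: has_integral_iff)
    also have "\<dots> \<le> 1 / b\<^sup>2" by simp
    finally show ?thesis by (simp add: p_def)
  qed
  \<comment> \<open>Length 2 b / sqrt 3 along the direction pi / 6 is what puts the end of the ray
    vertically above b.\<close>
  have endpoint: "of_real (2 * b / s) * w = of_real b + \<i> * of_real (b / s)" for b
    using s by (simp add: w complex_eq_iff flip: s_def)
  have "((\<lambda>b. of_real (integral {0..2 * b / s} (\<lambda>t. exp (- (t ^ 3)))) * w) \<longlongrightarrow> of_real (Gamma (1 / 3) / 3) * w) at_top"
  proof (intro tendsto_intros filterlim_compose[OF tendsto_integral_exp_minus_cube])
    have "s > 0" by fact
    then show "filterlim (\<lambda>b. 2 * b / s) at_top at_top" by real_asymp
  qed
  moreover have "((\<lambda>b. integral {0..b} (\<lambda>t. exp (\<i> * of_real (t ^ 3))) -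
      of_real (integral {0..2 * b / s} (\<lambda>t. exp (- (t ^ 3)))) * w) \<longlongrightarrow> 0) at_top"
  proof (rule Lim_null_comparison)
    show "\<forall>\<^sub>F b in at_top. norm (integral {0..b} (\<lambda>t. exp (\<i> * of_real (t ^ 3))) -
      of_real (integral {0..2 * b / s} (\<lambda>t. exp (- (t ^ 3)))) * w) \<le> 1 / b\<^sup>2"
      using eventually_gt_at_top[of 0]
    proof eventually_elim
      case (elim b)
      then show ?case
        using vertical[of b] s
        by (subst horizontal, simp, subst diagonal, simp, subst endpoint) (simp add: norm_minus_commute)
    qed
    show "((\<lambda>b::real. 1 / b\<^sup>2) \<longlongrightarrow> 0) at_top" by real_asymp
  qed
  ultimately show ?thesis unfolding w_def
    using tendsto_add by fastforce
qed

subsection \<open>Localisation at the scale of the denominator\<close>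

text \<open>Dominated convergence for a real parameter, tested along sequences approaching a from
  the right.\<close>

lemma dominated_convergence_at_right:
  fixes f :: "real \<Rightarrow> 'n::euclidean_space \<Rightarrow> 'm::euclidean_space"
  assumes f: "\<And>r. r > a \<Longrightarrow> f r integrable_on S" and h: "h integrable_on S"
    and le: "\<And>r t. r > a \<Longrightarrow> t \<in> S \<Longrightarrow> norm (f r t) \<le> h t"
    and lim: "\<And>t. t \<in> S \<Longrightarrow> ((\<lambda>r. f r t) \<longlongrightarrow> g t) (at_right a)"
  shows "((\<lambda>r. integral S (f r)) \<longlongrightarrow> integral S g) (at_right a)"
  unfolding tendsto_at_iff_sequentially comp_def
proof (intro allI impI)
  fix X :: "nat \<Rightarrow> real" assume X: "\<forall>i. X i \<in> {a<..} - {a}" "X \<longlonglongrightarrow> a"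
  then have "\<forall>\<^sub>F i in sequentially. X i \<in> {a<..} \<and> X i \<noteq> a"
    by (intro always_eventually) blast
  with X have X': "filterlim X (at_right a) sequentially"
    unfolding filterlim_at by blast
  show "(\<lambda>i. integral S (f (X i))) \<longlonglongrightarrow> integral S g"
    by (rule dominated_convergence(2)[OF f h le filterlim_compose[OF lim X']]) (use X in auto)
qed

lemma integral_scale:
  fixes f :: "real \<Rightarrow> 'a::euclidean_space"
  assumes "c > 0"
  shows "integral {0..c * b} f = c *\<^sub>R integral {0..b} (\<lambda>t. f (c * t))"
proof -
  have "(\<lambda>t. t / c) ` {0..c * b} = {0..b}"
  proof (intro equalityI subsetI)
    fix t assume "t \<in> {0..b}"
    then show "t \<in> (\<lambda>t. t / c) ` {0..c * b}"
      using assms by (intro image_eqI[of _ _ "c * t"]) auto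
  qed (use assms in \<open>auto simp: field_simps\<close>)
  then show ?thesis using integral_stretch_real[of c 0 "c * b" f] assms by simp
qed

text \<open>Up to pi / 3 the cosine is at least 1/2, so sin y - y / 2 increases from 0. Beyond, sin
  y \<ge> sqrt 3 / 2 \<ge> 0.85, which exceeds pi / 4 \<ge> y / 2.\<close>

lemma half_le_sin:
  fixes y :: real
  assumes "0 \<le> y" "y \<le> pi / 2"
  shows "y / 2 \<le> sin y"
proof (cases "y \<le> pi / 3")
  case True
  have "(\<lambda>y. sin y - y / 2) 0 \<le> (\<lambda>y. sin y - y / 2) y"
  proof (rule DERIV_nonneg_imp_nondecreasing[OF \<open>0 \<le> y\<close>])
    fix t assume t: "0 \<le> t" "t \<le> y"
    have "cos (pi / 3) \<le> cos t" by (rule cos_monotone_0_pi_le) (use t True in auto)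
    then show "\<exists>d. ((\<lambda>y. sin y - y / 2) has_real_derivative d) (at t) \<and> 0 \<le> d"
      by (intro exI[of _ "cos t - 1 / 2"]) (auto intro!: derivative_eq_intros simp: cos_60)
  qed
  then show ?thesis by simp
next
  case False
  have "sin (pi / 3) \<le> sin y" by (rule sin_monotone_2pi_le) (use False assms in auto)
  moreover have "sqrt 3 \<ge> 1.7" by (rule real_le_rsqrt) (simp add: power2_eq_square)
  ultimately show ?thesis using assms pi_less_4 pi_approx by (simp add: sin_60)
qed

text \<open>From 1 - cos y = 2 sin^2 (y / 2) and the linear lower bound for the sine. It bounds the
  phase derivative x (1 - cos u) from below.\<close>

lemma one_minus_cos_ge:
  fixes y :: real
  assumes "0 \<le> y" "y \<le> pi"
  shows "y\<^sup>2 / 8 \<le> 1 - cos y"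
proof -
  have "(y / 2 / 2)\<^sup>2 \<le> (sin (y / 2))\<^sup>2"
    by (intro power_mono half_le_sin) (use assms in auto)
  then show ?thesis using cos_double_sin[of "y / 2"] by (simp add: power_divide)
qed

text \<open>Substitute u = \<rho> t. The factor \<rho>^2 so produced cancels against the
  denominator, leaving 1 + (sin (\<rho> t) / \<rho>)^2. The phase affects only a factor of modulus
  1, so an arbitrary \<open>P\<close> is allowed and both endpoints are covered.\<close>

lemma tendsto_localised_integral:
  fixes P :: "real \<Rightarrow> real \<Rightarrow> real"
  assumes cont: "\<And>\<rho>. \<rho> > 0 \<Longrightarrow> continuous_on {0..pi / 2} (P \<rho>)"
    and lim: "\<And>t. t \<ge> 0 \<Longrightarrow> ((\<lambda>\<rho>. P \<rho> (\<rho> * t)) \<longlongrightarrow> q t) (at_right 0)"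
  shows "((\<lambda>\<rho>. of_real \<rho> * integral {0..pi / 2} (\<lambda>u. exp (\<i> * of_real (P \<rho> u)) / of_real (\<rho>\<^sup>2 + (sin u)\<^sup>2)))
    \<longlongrightarrow> integral {0..} (\<lambda>t. exp (\<i> * of_real (q t)) / of_real (1 + t\<^sup>2))) (at_right 0)"
proof -
  define f where "f \<rho> t = exp (\<i> * of_real (P \<rho> (\<rho> * t))) / complex_of_real (1 + (sin (\<rho> * t) / \<rho>)\<^sup>2)" for \<rho> t
  \<comment> \<open>Extension by zero puts all integrands on one half-line, although the rescaled
    interval depends on \<rho>.\<close>
  define h where "h \<rho> t = (if t \<in> {0..pi / 2 / \<rho>} then f \<rho> t else 0)" for \<rho> t
  have pos: "1 + (sin (\<rho> * t) / \<rho>)\<^sup>2 > 0" for \<rho> t :: real by (simp add: add_pos_nonneg)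
  have fint: "f \<rho> integrable_on {0..pi / 2 / \<rho>}" if "\<rho> > 0" for \<rho>
  proof -
    have "continuous_on {0..pi / 2 / \<rho>} (\<lambda>t. P \<rho> (\<rho> * t))"
      by (rule continuous_on_compose2[OF cont[OF that]])
        (use that in \<open>auto intro!: continuous_intros simp: field_simps\<close>)
    then show ?thesis
      unfolding f_def using that pos
      by (intro integrable_continuous_real continuous_intros) (auto simp: less_imp_neq[THEN not_sym] simp del: of_real_add)
  qed
  have eq: "of_real \<rho> * integral {0..pi / 2} (\<lambda>u. exp (\<i> * of_real (P \<rho> u)) / of_real (\<rho>\<^sup>2 + (sin u)\<^sup>2))
      = integral {0..} (h \<rho>)" if \<rho>: "\<rho> > 0" for \<rho>
  proof -
    have "of_real \<rho> * integral {0..\<rho> * (pi / 2 / \<rho>)} (\<lambda>u. exp (\<i> * of_real (P \<rho> u)) / of_real (\<rho>\<^sup>2 + (sin u)\<^sup>2))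
      = of_real (\<rho>\<^sup>2) * integral {0..pi / 2 / \<rho>} (\<lambda>t. exp (\<i> * of_real (P \<rho> (\<rho> * t))) / of_real (\<rho>\<^sup>2 + (sin (\<rho> * t))\<^sup>2))"
      by (subst integral_scale[OF \<rho>]) (simp add: scaleR_conv_of_real power2_eq_square)
    also have "\<dots> = integral {0..pi / 2 / \<rho>} (\<lambda>t. of_real (\<rho>\<^sup>2) * (exp (\<i> * of_real (P \<rho> (\<rho> * t))) / of_real (\<rho>\<^sup>2 + (sin (\<rho> * t))\<^sup>2)))"
      by (rule integral_mult_right [symmetric])
    also have "\<dots> = integral {0..pi / 2 / \<rho>} (f \<rho>)"
    proof (rule integral_cong)
      fix t
      have "\<rho>\<^sup>2 + (sin (\<rho> * t))\<^sup>2 = \<rho>\<^sup>2 * (1 + (sin (\<rho> * t) / \<rho>)\<^sup>2)"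
        using \<rho> by (simp add: field_simps)
      then show "of_real (\<rho>\<^sup>2) * (exp (\<i> * of_real (P \<rho> (\<rho> * t))) / of_real (\<rho>\<^sup>2 + (sin (\<rho> * t))\<^sup>2)) = f \<rho> t"
        unfolding f_def using \<rho> by (simp del: of_real_add of_real_power)
    qed
    also have "\<dots> = integral {0..} (h \<rho>)"
      unfolding h_def by (simp add: integral_restrict_Int Int_absorb2 del: atLeastAtMost_iff)
    finally show ?thesis using \<rho> by simp
  qed
  have "((\<lambda>\<rho>. integral {0..} (h \<rho>)) \<longlongrightarrow>
      integral {0..} (\<lambda>t. exp (\<i> * of_real (q t)) / of_real (1 + t\<^sup>2))) (at_right 0)"
  proof (rule dominated_convergence_at_right)
    show "h \<rho> integrable_on {0..}" if "\<rho> > 0" for \<rho>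
      using has_integral_restrict[of "{0..pi / 2 / \<rho>}" "{0..}" "f \<rho>"] fint[OF that]
      unfolding h_def by (auto simp: integrable_on_def)
    show "(\<lambda>t. 4 * (1 / (1 + t\<^sup>2)) :: real) integrable_on {0..}"
      using has_integral_mult_right[OF has_integral_inverse_1_plus_square, of 4]
      by (auto simp: integrable_on_def)
    fix t :: real
    show "norm (h \<rho> t) \<le> 4 * (1 / (1 + t\<^sup>2))" if "\<rho> > 0" "t \<in> {0..}" for \<rho>
    proof (cases "t \<in> {0..pi / 2 / \<rho>}")
      case True
      \<comment> \<open>The linear bound for the sine makes the denominator at least 1 + t^2 / 4
        \<ge> (1 + t^2) / 4, whence the majorant with factor 4.\<close>
      then have "\<rho> * t / 2 \<le> sin (\<rho> * t)"
        using that by (intro half_le_sin) (auto simp: field_simps)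
      then have "t / 2 \<le> sin (\<rho> * t) / \<rho>" using that by (simp add: field_simps)
      then have "(t / 2)\<^sup>2 \<le> (sin (\<rho> * t) / \<rho>)\<^sup>2" using that by (intro power_mono) auto
      then have "(1 + t\<^sup>2) / 4 \<le> 1 + (sin (\<rho> * t) / \<rho>)\<^sup>2" by (simp add: power_divide)
      moreover have "1 + t\<^sup>2 > 0" by (simp add: add_pos_nonneg)
      ultimately have "1 / (1 + (sin (\<rho> * t) / \<rho>)\<^sup>2) \<le> 1 / ((1 + t\<^sup>2) / 4)"
        by (intro divide_left_mono mult_pos_pos pos) auto
      moreover have "norm (f \<rho> t) = 1 / (1 + (sin (\<rho> * t) / \<rho>)\<^sup>2)"
        unfolding f_def norm_divide norm_of_real using pos[of \<rho> t] by simp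
      ultimately show ?thesis using True by (simp add: h_def)
    next
      case False
      then show ?thesis by (simp only: h_def if_False) simp
    qed
    assume t: "t \<in> {0..}"
    have "((\<lambda>\<rho>. sin (\<rho> * t) / \<rho>) \<longlongrightarrow> t) (at_right 0)" by real_asymp
    then have "((\<lambda>\<rho>. f \<rho> t) \<longlongrightarrow> exp (\<i> * of_real (q t)) / of_real (1 + t\<^sup>2)) (at_right 0)"
      unfolding f_def using t lim[of t]
      by (intro tendsto_intros) (auto simp: add_pos_nonneg less_imp_neq[THEN not_sym] simp del: of_real_add of_real_power)
    moreover have "filterlim (\<lambda>\<rho>. pi / 2 / \<rho>) at_top (at_right 0)" by real_asymp
    then have "\<forall>\<^sub>F \<rho> in at_right 0. t \<le> pi / 2 / \<rho>" by (simp add: filterlim_at_top)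
    then have "\<forall>\<^sub>F \<rho> in at_right 0. f \<rho> t = h \<rho> t"
      by eventually_elim (use t in \<open>simp add: h_def\<close>)
    ultimately show "((\<lambda>\<rho>. h \<rho> t) \<longlongrightarrow> exp (\<i> * of_real (q t)) / of_real (1 + t\<^sup>2)) (at_right 0)"
      by (rule Lim_transform_eventually)
  qed
  then show ?thesis
    by (rule Lim_transform_eventually) (use eq in \<open>auto simp: eventually_at_filter\<close>)
qed

text \<open>The contributions of the halves next to \<open>\<theta> = \<pi>\<close> (with \<open>u = \<pi> - \<theta>\<close>) and \<open>\<theta> = 0\<close>.\<close>

definition pi_integral :: "real \<Rightarrow> real \<Rightarrow> real \<Rightarrow> real \<Rightarrow> complex" where
  "pi_integral x \<rho> a b =
     integral {a..b} (\<lambda>u. exp (\<i> * of_real (x * (u - sin u))) / of_real (\<rho>\<^sup>2 + (sin u)\<^sup>2))"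

definition zero_integral :: "real \<Rightarrow> real \<Rightarrow> real" where
  "zero_integral x \<rho> = integral {0..pi / 2} (\<lambda>u. cos (x * (u + sin u)) / (\<rho>\<^sup>2 + (sin u)\<^sup>2))"

section \<open>Bounds for the two halves and decomposition of the Good function\<close>

lemma antimono_on_weight:
  fixes \<rho> :: real
  assumes "\<rho> > 0"
  shows "antimono_on {0..pi / 2} (\<lambda>u. 1 / (\<rho>\<^sup>2 + (sin u)\<^sup>2))"
proof (rule monotone_onI)
  fix u v :: real assume "u \<in> {0..pi / 2}" "v \<in> {0..pi / 2}" "u \<le> v"
  then have "(sin u)\<^sup>2 \<le> (sin v)\<^sup>2"
    by (intro power_mono sin_monotone_2pi_le sin_ge_zero) auto
  then show "1 / (\<rho>\<^sup>2 + (sin v)\<^sup>2) \<le> 1 / (\<rho>\<^sup>2 + (sin u)\<^sup>2)"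
    using assms by (intro divide_left_mono mult_pos_pos add_pos_nonneg) auto
qed

lemma weight_le:
  fixes \<rho> :: real
  assumes "\<rho> > 0"
  shows "\<bar>1 / (\<rho>\<^sup>2 + (sin u)\<^sup>2)\<bar> \<le> 1 / \<rho>\<^sup>2"
  using assms by (auto simp: abs_of_pos add_pos_nonneg intro!: divide_left_mono)

lemma continuous_on_weight:
  fixes \<rho> :: real
  assumes "\<rho> > 0"
  shows "continuous_on A (\<lambda>u. 1 / (\<rho>\<^sup>2 + (sin u)\<^sup>2))"
  using assms by (intro continuous_intros) (metis add_pos_nonneg less_irrefl zero_le_power2 zero_less_power)

text \<open>The phase derivative x (1 + cos u) is at least x on [0, pi / 2], so the first-derivative
  test applies with a decreasing amplitude of size at most 1 / \<rho>^2.\<close>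

lemma abs_zero_integral_le:
  assumes "x > 0" "\<rho> > 0"
  shows "\<bar>zero_integral x \<rho>\<bar> \<le> 8 / (\<rho>\<^sup>2 * x)"
proof -
  have "\<bar>integral {0..pi / 2} (\<lambda>u. 1 / (\<rho>\<^sup>2 + (sin u)\<^sup>2) * cos (x * (u + sin u)))\<bar> \<le> 8 * (1 / \<rho>\<^sup>2) / x"
  proof (rule abs_integral_monotone_cos_le[where \<phi>' = "\<lambda>u. x * (1 + cos u)"])
    show "((\<lambda>u. x * (u + sin u)) has_real_derivative x * (1 + cos u)) (at u within {0..pi / 2})" for u
      by (auto intro!: derivative_eq_intros)
    show "x \<le> x * (1 + cos u)" if "u \<in> {0..pi / 2}" for u
      using that assms cos_ge_zero[of u] by (auto simp: algebra_simps)
    have "antimono_on {0..pi / 2} (\<lambda>u. x * (1 + cos u))"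
      using assms by (intro monotone_onI mult_left_mono add_left_mono cos_monotone_0_pi_le) auto
    then show "mono_on {0..pi / 2} (\<lambda>u. x * (1 + cos u)) \<or> antimono_on {0..pi / 2} (\<lambda>u. x * (1 + cos u))" ..
  qed (use assms antimono_on_weight weight_le in auto)
  then show ?thesis by (simp add: zero_integral_def)
qed

text \<open>Away from the degenerate point u = 0 the phase derivative x (1 - cos u) is at least x
  a^2 / 8; the constant is 16 * 8.\<close>

lemma norm_pi_integral_tail_le:
  assumes "x > 0" "\<rho> > 0" "0 < a" "a \<le> pi / 2"
  shows "norm (pi_integral x \<rho> a (pi / 2)) \<le> 128 / (\<rho>\<^sup>2 * x * a\<^sup>2)"
proof -
  have "norm (integral {a..pi / 2} (\<lambda>u. of_real (1 / (\<rho>\<^sup>2 + (sin u)\<^sup>2)) * exp (\<i> * of_real (x * (u - sin u)))))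
      \<le> 16 * (1 / \<rho>\<^sup>2) / (x * (a\<^sup>2 / 8))"
  proof (rule norm_integral_monotone_exp_le[where \<phi>' = "\<lambda>u. x * (1 - cos u)"])
    show "((\<lambda>u. x * (u - sin u)) has_real_derivative x * (1 - cos u)) (at u within {a..pi / 2})" for u
      by (auto intro!: derivative_eq_intros)
    show "x * (a\<^sup>2 / 8) \<le> x * (1 - cos u)" if "u \<in> {a..pi / 2}" for u
    proof -
      have "a\<^sup>2 / 8 \<le> 1 - cos a" by (rule one_minus_cos_ge) (use assms in auto)
      moreover have "cos u \<le> cos a" by (rule cos_monotone_0_pi_le) (use that assms in auto)
      ultimately show ?thesis using assms by (intro mult_left_mono) auto
    qed
    have "mono_on {a..pi / 2} (\<lambda>u. x * (1 - cos u))"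
      using assms by (intro monotone_onI mult_left_mono diff_left_mono cos_monotone_0_pi_le) auto
    then show "mono_on {a..pi / 2} (\<lambda>u. x * (1 - cos u)) \<or> antimono_on {a..pi / 2} (\<lambda>u. x * (1 - cos u))" ..
    have "antimono_on {a..pi / 2} (\<lambda>u. 1 / (\<rho>\<^sup>2 + (sin u)\<^sup>2))"
      using assms by (intro monotone_on_subset[OF antimono_on_weight]) auto
    then show "mono_on {a..pi / 2} (\<lambda>u. 1 / (\<rho>\<^sup>2 + (sin u)\<^sup>2)) \<or> antimono_on {a..pi / 2} (\<lambda>u. 1 / (\<rho>\<^sup>2 + (sin u)\<^sup>2))" ..
  qed (use assms weight_le continuous_on_weight in auto)
  then show ?thesis by (simp add: pi_integral_def)
qed

text \<open>Under u = pi - \<theta> the phase becomes pi x - x (u - sin u). Factoring out exp(\<i>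
  pi x), which has no limit, leaves a conjugated integral whose asymptotics can be taken
  separately.\<close>

lemma restricted_Good_eq:
  assumes \<rho>: "\<rho> > 0"
  shows "restricted_Good x \<rho> =
    (zero_integral x \<rho> + Re (exp (\<i> * of_real (pi * x)) * cnj (pi_integral x \<rho> 0 (pi / 2)))) / pi"
proof -
  define f where "f \<theta> = cos (x * (\<theta> + sin \<theta>)) / (\<rho>\<^sup>2 + (sin \<theta>)\<^sup>2)" for \<theta>
  have nz: "\<rho>\<^sup>2 + (sin u)\<^sup>2 \<noteq> 0" for u
    using \<rho> by (metis add_pos_nonneg less_irrefl zero_le_power2 zero_less_power)
  have f: "f integrable_on {a..b}" for a b
    unfolding f_def by (intro integrable_continuous_real continuous_intros) (metis nz)
  let ?e = "\<lambda>u. exp (\<i> * of_real (x * (u - sin u))) / complex_of_real (\<rho>\<^sup>2 + (sin u)\<^sup>2)"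
  have e: "?e integrable_on {0..pi / 2}"
    by (intro integrable_continuous_real continuous_intros) (metis nz of_real_eq_0_iff)
  have "bounded_linear (\<lambda>z. Re (exp (\<i> * of_real (pi * x)) * cnj z))"
    by (intro bounded_linear_compose[OF bounded_linear_Re]
        bounded_linear_compose[OF bounded_linear_mult_right] bounded_linear_cnj)
  from integral_linear[OF e this]
  have "Re (exp (\<i> * of_real (pi * x)) * cnj (pi_integral x \<rho> 0 (pi / 2))) =
      integral {0..pi / 2} (\<lambda>u. Re (exp (\<i> * of_real (pi * x)) * cnj (?e u)))"
    by (simp only: pi_integral_def o_def)
  also have "\<dots> = integral {0..pi / 2} (\<lambda>u. f (- (u - pi)))"
  proof (rule integral_cong)
    fix u
    have "Re (exp (\<i> * of_real (pi * x)) * cnj (?e u)) =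
        Re (exp (\<i> * of_real (pi * x)) * cnj (exp (\<i> * of_real (x * (u - sin u))))) / (\<rho>\<^sup>2 + (sin u)\<^sup>2)"
      by (metis (no_types) Re_divide_of_real complex_cnj_complex_of_real complex_cnj_divide times_divide_eq_right)
    also have "Re (exp (\<i> * of_real (pi * x)) * cnj (exp (\<i> * of_real (x * (u - sin u))))) = cos (pi * x - x * (u - sin u))"
      by (simp add: Re_exp Im_exp cos_diff)
    also have "pi * x - x * (u - sin u) = x * (- (u - pi) + sin (- (u - pi)))"
      by (simp add: algebra_simps)
    finally show "Re (exp (\<i> * of_real (pi * x)) * cnj (?e u)) = f (- (u - pi))"
      by (simp add: f_def)
  qed
  also have "\<dots> = integral {pi / 2..pi} f"
    using integral_shift_real_ivl[where a = "- pi" and b = "- (pi / 2)" and c = "- pi" and f = "\<lambda>u. f (- u)"]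
      integral_reflect_real[of pi "pi / 2" f]
    by simp
  finally have "Re (exp (\<i> * of_real (pi * x)) * cnj (pi_integral x \<rho> 0 (pi / 2))) = integral {pi / 2..pi} f" .
  moreover have "zero_integral x \<rho> = integral {0..pi / 2} f"
    unfolding zero_integral_def f_def ..
  moreover have "restricted_Good x \<rho> = integral {0..pi} f / pi"
    unfolding restricted_Good_def f_def by simp
  moreover have "integral {0..pi / 2} f + integral {pi / 2..pi} f = integral {0..pi} f"
    by (rule Henstock_Kurzweil_Integration.integral_combine[OF _ _ f]) auto
  ultimately show ?thesis by (simp only:)
qed

section \<open>The cubic stationary point at \<theta> = pi\<close>

lemma tendsto_integral_exp_ii_cube_div_6:
  "((\<lambda>b::real. integral {0..b} (\<lambda>t. exp (\<i> * of_real (t ^ 3 / 6)))) \<longlongrightarrow>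
     of_real (6 powr (1 / 3) * Gamma (1 / 3) / 3) * exp (\<i> * of_real (pi / 6))) at_top"
proof -
  define c :: real where "c = 6 powr (1 / 3)"
  have c: "c > 0" "c ^ 3 = 6" by (simp_all add: c_def powr_power)
  have eq: "integral {0..b} (\<lambda>t. exp (\<i> * of_real (t ^ 3 / 6))) =
      of_real c * integral {0..b / c} (\<lambda>t. exp (\<i> * of_real (t ^ 3)))" for b
    using integral_scale[OF c(1), of "b / c" "\<lambda>t. exp (\<i> * of_real (t ^ 3 / 6))"] c
    by (simp add: power_mult_distrib scaleR_conv_of_real flip: of_real_power)
  have "((\<lambda>b. of_real c * integral {0..b / c} (\<lambda>t. exp (\<i> * of_real (t ^ 3)))) \<longlongrightarrow>
      of_real c * (of_real (Gamma (1 / 3) / 3) * exp (\<i> * of_real (pi / 6)))) at_top"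
  proof (intro tendsto_intros filterlim_compose[OF tendsto_integral_exp_ii_cube])
    have "c > 0" by fact
    then show "filterlim (\<lambda>b. b / c) at_top at_top" by real_asymp
  qed
  then show ?thesis unfolding eq by (simp add: c_def mult_ac)
qed

text \<open>Here k is the cube root of x and u = t / k. The phase tends to t^3 / 6, and the weight
  times \<rho>^2 tends to 1 because |sin (t / k)| / \<rho> \<le> |t| / (\<rho> k). On a bounded
  t-interval the constant 1 dominates.\<close>

lemma tendsto_pi_integral_initial:
  fixes k :: "real \<Rightarrow> real"
  assumes k: "\<And>\<rho>. \<rho> > 0 \<Longrightarrow> k \<rho> > 0"
    and k_lim: "filterlim k at_top (at_right 0)"
    and rho_k: "filterlim (\<lambda>\<rho>. \<rho> * k \<rho>) at_top (at_right 0)"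
  shows "((\<lambda>\<rho>. of_real (\<rho>\<^sup>2 * k \<rho>) * pi_integral (k \<rho> ^ 3) \<rho> 0 (b / k \<rho>)) \<longlongrightarrow>
    integral {0..b} (\<lambda>t. exp (\<i> * of_real (t ^ 3 / 6)))) (at_right 0)"
proof -
  define f where "f \<rho> t = exp (\<i> * of_real (k \<rho> ^ 3 * (t / k \<rho> - sin (t / k \<rho>)))) /
    complex_of_real (1 + (sin (t / k \<rho>) / \<rho>)\<^sup>2)" for \<rho> t
  have pos: "1 + (sin (t / k \<rho>) / \<rho>)\<^sup>2 > 0" for \<rho> t by (simp add: add_pos_nonneg)
  have eq: "of_real (\<rho>\<^sup>2 * k \<rho>) * pi_integral (k \<rho> ^ 3) \<rho> 0 (b / k \<rho>) = integral {0..b} (f \<rho>)" if \<rho>: "\<rho> > 0" for \<rho>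
  proof -
    let ?e = "\<lambda>u. exp (\<i> * of_real (k \<rho> ^ 3 * (u - sin u))) / complex_of_real (\<rho>\<^sup>2 + (sin u)\<^sup>2)"
    have "of_real (\<rho>\<^sup>2 * k \<rho>) * integral {0..1 / k \<rho> * b} ?e = of_real (\<rho>\<^sup>2) * integral {0..b} (\<lambda>t. ?e (1 / k \<rho> * t))"
      using k[OF \<rho>] by (subst integral_scale) (simp_all add: scaleR_conv_of_real)
    also have "\<dots> = integral {0..b} (\<lambda>t. of_real (\<rho>\<^sup>2) * ?e (1 / k \<rho> * t))"
      by (rule integral_mult_right [symmetric])
    also have "\<dots> = integral {0..b} (f \<rho>)"
    proof (rule integral_cong)
      fix t
      have "\<rho>\<^sup>2 + (sin (1 / k \<rho> * t))\<^sup>2 = \<rho>\<^sup>2 * (1 + (sin (t / k \<rho>) / \<rho>)\<^sup>2)"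
        using \<rho> by (simp add: field_simps)
      then show "of_real (\<rho>\<^sup>2) * ?e (1 / k \<rho> * t) = f \<rho> t"
        unfolding f_def using \<rho> by (simp del: of_real_add of_real_power)
    qed
    finally show ?thesis by (simp add: pi_integral_def)
  qed
  have "((\<lambda>\<rho>. integral {0..b} (f \<rho>)) \<longlongrightarrow> integral {0..b} (\<lambda>t. exp (\<i> * of_real (t ^ 3 / 6)))) (at_right 0)"
  proof (rule dominated_convergence_at_right)
    show "f \<rho> integrable_on {0..b}" if "\<rho> > 0" for \<rho>
      unfolding f_def using k[OF that] that pos
      by (intro integrable_continuous_real continuous_intros)
        (auto simp: less_imp_neq[THEN not_sym] simp del: of_real_add)
    show "(\<lambda>t. 1 :: real) integrable_on {0..b}" by (intro integrable_continuous_real continuous_intros)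
    show "norm (f \<rho> t) \<le> 1" for \<rho> t
      unfolding f_def norm_divide norm_of_real using pos[of t \<rho>] by simp
    fix t
    have "((\<lambda>k::real. k ^ 3 * (t / k - sin (t / k))) \<longlongrightarrow> t ^ 3 / 6) at_top"
      by real_asymp (simp add: power3_eq_cube)
    then have 1: "((\<lambda>\<rho>. k \<rho> ^ 3 * (t / k \<rho> - sin (t / k \<rho>))) \<longlongrightarrow> t ^ 3 / 6) (at_right 0)"
      by (rule filterlim_compose[OF _ k_lim])
    have 2: "((\<lambda>\<rho>. sin (t / k \<rho>) / \<rho>) \<longlongrightarrow> 0) (at_right 0)"
    proof (rule Lim_null_comparison)
      show "\<forall>\<^sub>F \<rho> in at_right 0. norm (sin (t / k \<rho>) / \<rho>) \<le> \<bar>t\<bar> / (\<rho> * k \<rho>)"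
        unfolding eventually_at_filter
      proof (intro always_eventually allI impI)
        fix \<rho> :: real assume \<rho>: "\<rho> \<in> {0<..}"
        have "\<bar>sin (t / k \<rho>)\<bar> / \<rho> \<le> \<bar>t / k \<rho>\<bar> / \<rho>"
          using \<rho> by (intro divide_right_mono abs_sin_x_le_abs_x) auto
        then show "norm (sin (t / k \<rho>) / \<rho>) \<le> \<bar>t\<bar> / (\<rho> * k \<rho>)"
          using \<rho> k[of \<rho>] by (simp add: abs_divide mult.commute)
      qed
      show "((\<lambda>\<rho>. \<bar>t\<bar> / (\<rho> * k \<rho>)) \<longlongrightarrow> 0) (at_right 0)"
        by (rule tendsto_divide_0[OF tendsto_const filterlim_at_top_imp_at_infinity[OF rho_k]])
    qed
    have "((\<lambda>\<rho>. f \<rho> t) \<longlongrightarrow> exp (\<i> * of_real (t ^ 3 / 6)) / complex_of_real (1 + 0\<^sup>2)) (at_right 0)"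
      unfolding f_def by (intro tendsto_intros 1 2) simp
    then show "((\<lambda>\<rho>. f \<rho> t) \<longlongrightarrow> exp (\<i> * of_real (t ^ 3 / 6))) (at_right 0)" by simp
  qed
  then show ?thesis
    by (rule Lim_transform_eventually) (use eq in \<open>auto simp: eventually_at_filter\<close>)
qed

text \<open>Cut at u = b / k. After normalisation the tail is at most 128 / b^2 uniformly in \<rho>,
  so b is fixed first to make the tail and the Fresnel remainder small, and then \<rho> tends to
  0.\<close>

lemma tendsto_pi_integral:
  fixes k :: "real \<Rightarrow> real"
  assumes k: "\<And>\<rho>. \<rho> > 0 \<Longrightarrow> k \<rho> > 0"
    and k_lim: "filterlim k at_top (at_right 0)"
    and rho_k: "filterlim (\<lambda>\<rho>. \<rho> * k \<rho>) at_top (at_right 0)"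
  shows "((\<lambda>\<rho>. of_real (\<rho>\<^sup>2 * k \<rho>) * pi_integral (k \<rho> ^ 3) \<rho> 0 (pi / 2)) \<longlongrightarrow>
    of_real (6 powr (1 / 3) * Gamma (1 / 3) / 3) * exp (\<i> * of_real (pi / 6))) (at_right 0)"
    (is "(?Z \<longlongrightarrow> ?L) _")
proof (rule tendstoI)
  fix e :: real assume e: "e > 0"
  let ?I = "\<lambda>b. integral {0..b} (\<lambda>t. exp (\<i> * of_real (t ^ 3 / 6)))"
  have "((\<lambda>b::real. 128 / b\<^sup>2) \<longlongrightarrow> 0) at_top" by real_asymp
  then have "\<forall>\<^sub>F b :: real in at_top. dist (128 / b\<^sup>2) 0 < e / 3" using e by (intro tendstoD) auto
  moreover have "\<forall>\<^sub>F b in at_top. dist (?I b) ?L < e / 3"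
    using e by (intro tendstoD[OF tendsto_integral_exp_ii_cube_div_6]) auto
  ultimately have "\<forall>\<^sub>F b in at_top. b > 0 \<and> 128 / b\<^sup>2 < e / 3 \<and> dist (?I b) ?L < e / 3"
    using eventually_gt_at_top[of 0] by eventually_elim auto
  then obtain b where b: "b > 0" "128 / b\<^sup>2 < e / 3" "dist (?I b) ?L < e / 3"
    by (auto dest: eventually_happens)
  have "\<forall>\<^sub>F \<rho> in at_right 0. dist (of_real (\<rho>\<^sup>2 * k \<rho>) * pi_integral (k \<rho> ^ 3) \<rho> 0 (b / k \<rho>)) (?I b) < e / 3"
    using e by (intro tendstoD[OF tendsto_pi_integral_initial[OF k k_lim rho_k]]) auto
  \<comment> \<open>This guarantees that the cut b / k lies in [0, pi / 2].\<close>
  moreover have "\<forall>\<^sub>F \<rho> in at_right 0. 2 * b / pi \<le> k \<rho>"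
    using k_lim by (simp add: filterlim_at_top)
  moreover have "\<forall>\<^sub>F \<rho> in at_right 0. \<rho> > (0::real)" by (simp add: eventually_at_filter)
  ultimately show "\<forall>\<^sub>F \<rho> in at_right 0. dist (?Z \<rho>) ?L < e"
  proof eventually_elim
    case (elim \<rho>)
    define a where "a = b / k \<rho>"
    have kp: "k \<rho> > 0" using k elim by simp
    have a: "0 < a" "a \<le> pi / 2" using elim kp b by (auto simp: a_def field_simps)
    have "continuous_on {0..pi / 2} (\<lambda>u. exp (\<i> * of_real (k \<rho> ^ 3 * (u - sin u))) / complex_of_real (\<rho>\<^sup>2 + (sin u)\<^sup>2))"
      using elim by (intro continuous_intros) (metis add_pos_nonneg less_irrefl of_real_eq_0_iff zero_le_power2 zero_less_power)
    from Henstock_Kurzweil_Integration.integral_combine[OF _ _ integrable_continuous_real[OF this], of a] a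
    have split: "pi_integral (k \<rho> ^ 3) \<rho> 0 (pi / 2) =
        pi_integral (k \<rho> ^ 3) \<rho> 0 a + pi_integral (k \<rho> ^ 3) \<rho> a (pi / 2)"
      unfolding pi_integral_def by simp
    have "norm (of_real (\<rho>\<^sup>2 * k \<rho>) * pi_integral (k \<rho> ^ 3) \<rho> a (pi / 2)) \<le>
        \<rho>\<^sup>2 * k \<rho> * (128 / (\<rho>\<^sup>2 * k \<rho> ^ 3 * a\<^sup>2))"
      unfolding norm_mult norm_of_real using kp elim a
      by (intro mult_mono norm_pi_integral_tail_le) auto
    also have "\<dots> = 128 / b\<^sup>2"
      using kp elim b by (simp add: a_def field_simps power2_eq_square power3_eq_cube)
    finally have "dist (?Z \<rho>) (of_real (\<rho>\<^sup>2 * k \<rho>) * pi_integral (k \<rho> ^ 3) \<rho> 0 a) < e / 3"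
      using b by (simp add: split distrib_left dist_norm)
    moreover have "dist (of_real (\<rho>\<^sup>2 * k \<rho>) * pi_integral (k \<rho> ^ 3) \<rho> 0 a) (?I b) < e / 3"
      using elim by (simp add: a_def)
    ultimately show ?case using b(3) by metric
  qed
qed

section \<open>Assembly of the asymptotics\<close>

text \<open>The factor exp(\<i> pi x) oscillates without a limit but has modulus 1. So the
  normalised error is at most the sum of the two limit errors over pi.\<close>

lemma restricted_Good_smallo:
  fixes x g M :: "real \<Rightarrow> real"
  assumes g: "\<And>\<rho>. \<rho> > 0 \<Longrightarrow> g \<rho> > 0"
    and Y: "((\<lambda>\<rho>. zero_integral (x \<rho>) \<rho> / g \<rho>) \<longlongrightarrow> Y) (at_right 0)"
    and W: "((\<lambda>\<rho>. pi_integral (x \<rho>) \<rho> 0 (pi / 2) / of_real (g \<rho>)) \<longlongrightarrow> W) (at_right 0)"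
    and M: "\<And>\<rho>. \<rho> > 0 \<Longrightarrow> M \<rho> = g \<rho> / pi * (Y + Re (exp (\<i> * of_real (pi * x \<rho>)) * cnj W))"
  shows "(\<lambda>\<rho>. restricted_Good (x \<rho>) \<rho> - M \<rho>) \<in> o[at_right 0](g)"
proof (rule smalloI_tendsto)
  let ?Y = "\<lambda>\<rho>. zero_integral (x \<rho>) \<rho> / g \<rho>"
  let ?W = "\<lambda>\<rho>. pi_integral (x \<rho>) \<rho> 0 (pi / 2) / of_real (g \<rho>)"
  have pos: "\<forall>\<^sub>F \<rho> in at_right 0. \<rho> > (0::real)" by (simp add: eventually_at_filter)
  then show "\<forall>\<^sub>F \<rho> in at_right 0. g \<rho> \<noteq> 0"
    by eventually_elim (use g in force)
  show "((\<lambda>\<rho>. (restricted_Good (x \<rho>) \<rho> - M \<rho>) / g \<rho>) \<longlongrightarrow> 0) (at_right 0)"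
  proof (rule Lim_null_comparison)
    show "\<forall>\<^sub>F \<rho> in at_right 0. norm ((restricted_Good (x \<rho>) \<rho> - M \<rho>) / g \<rho>) \<le>
        (\<bar>?Y \<rho> - Y\<bar> + norm (?W \<rho> - W)) / pi"
      using pos
    proof eventually_elim
      case (elim \<rho>)
      let ?E = "exp (\<i> * of_real (pi * x \<rho>))"
      have "Re (?E * cnj (?W \<rho>)) = Re (?E * cnj (pi_integral (x \<rho>) \<rho> 0 (pi / 2))) / g \<rho>"
        by (metis Re_divide_of_real complex_cnj_complex_of_real complex_cnj_divide times_divide_eq_right)
      then have "(restricted_Good (x \<rho>) \<rho> - M \<rho>) / g \<rho> = (?Y \<rho> - Y + Re (?E * cnj (?W \<rho> - W))) / pi"
        unfolding restricted_Good_eq[OF elim] M[OF elim] complex_cnj_diff right_diff_distrib minus_complex.simps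
        using g[OF elim] by (simp add: field_simps)
      moreover have "\<bar>Re (?E * cnj (?W \<rho> - W))\<bar> \<le> norm (?W \<rho> - W)"
        by (rule order_trans[OF abs_Re_le_cmod]) (simp only: norm_mult complex_mod_cnj norm_exp_i_times mult_1 order_refl)
      ultimately show ?case by (simp add: abs_divide divide_right_mono)
    qed
    have "((\<lambda>\<rho>. (\<bar>?Y \<rho> - Y\<bar> + norm (?W \<rho> - W)) / pi) \<longlongrightarrow> (\<bar>Y - Y\<bar> + norm (W - W)) / pi) (at_right 0)"
      by (intro tendsto_intros Y W) auto
    then show "((\<lambda>\<rho>. (\<bar>?Y \<rho> - Y\<bar> + norm (?W \<rho> - W)) / pi) \<longlongrightarrow> 0) (at_right 0)" by simp
  qed
qed

text \<open>The real part of the localised limit, with phase x (u + sin u).\<close>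

lemma tendsto_zero_integral:
  fixes x q :: "real \<Rightarrow> real"
  assumes q: "continuous_on {0..} q"
    and lim: "\<And>t. t \<ge> 0 \<Longrightarrow> ((\<lambda>\<rho>. x \<rho> * (\<rho> * t + sin (\<rho> * t))) \<longlongrightarrow> q t) (at_right 0)"
  shows "((\<lambda>\<rho>. \<rho> * zero_integral (x \<rho>) \<rho>) \<longlongrightarrow> integral {0..} (\<lambda>t. cos (q t) / (1 + t\<^sup>2))) (at_right 0)"
proof -
  let ?e = "\<lambda>\<rho> u. exp (\<i> * of_real (x \<rho> * (u + sin u))) / complex_of_real (\<rho>\<^sup>2 + (sin u)\<^sup>2)"
  let ?l = "\<lambda>t. exp (\<i> * of_real (q t)) / complex_of_real (1 + t\<^sup>2)"
  have pos: "1 + t\<^sup>2 > 0" for t :: real by (simp add: add_pos_nonneg)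
  have Re_div: "Re (exp (\<i> * of_real a) / of_real b) = cos a / b" for a b
    by (simp only: Re_divide_of_real) (simp add: Re_exp)
  have Re_of_real_mult: "Re (of_real a * z) = a * Re z" for a z by simp
  \<comment> \<open>Passing the real part through the half-line integral needs integrability of the
    complex limit: it is continuous, hence measurable, and bounded by 1 / (1 + t^2).\<close>
  have "continuous_on {0..} ?l"
    by (intro continuous_intros q) (metis pos less_irrefl of_real_eq_0_iff)
  then have "?l \<in> borel_measurable (lebesgue_on {0..})"
    by (rule continuous_imp_measurable_on_sets_lebesgue) simp
  then have "?l integrable_on {0..}"
  proof (rule measurable_bounded_by_integrable_imp_integrable)
    show "(\<lambda>t::real. 1 / (1 + t\<^sup>2)) integrable_on {0..}"
      by (rule has_integral_integrable[OF has_integral_inverse_1_plus_square])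
    show "norm (?l t) \<le> 1 / (1 + t\<^sup>2)" for t
      unfolding norm_divide norm_of_real using pos[of t] by simp
  qed simp
  from integral_linear[OF this bounded_linear_Re]
  have Re_l: "Re (integral {0..} ?l) = integral {0..} (\<lambda>t. cos (q t) / (1 + t\<^sup>2))"
    by (simp only: o_def Re_div)
  have Re_e: "Re (of_real \<rho> * integral {0..pi / 2} (?e \<rho>)) = \<rho> * zero_integral (x \<rho>) \<rho>" if "\<rho> > 0" for \<rho>
  proof -
    have "?e \<rho> integrable_on {0..pi / 2}"
      using that by (intro integrable_continuous_real continuous_intros)
        (metis add_pos_nonneg less_irrefl of_real_eq_0_iff zero_le_power2 zero_less_power)
    from integral_linear[OF this bounded_linear_Re]
    have "zero_integral (x \<rho>) \<rho> = Re (integral {0..pi / 2} (?e \<rho>))"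
      by (simp only: o_def Re_div zero_integral_def)
    then show ?thesis by (simp only: Re_of_real_mult)
  qed
  have "((\<lambda>\<rho>. of_real \<rho> * integral {0..pi / 2} (?e \<rho>)) \<longlongrightarrow> integral {0..} ?l) (at_right 0)"
    using lim by (intro tendsto_localised_integral continuous_intros) auto
  from tendsto_Re[OF this]
  have "((\<lambda>\<rho>. Re (of_real \<rho> * integral {0..pi / 2} (?e \<rho>))) \<longlongrightarrow>
      integral {0..} (\<lambda>t. cos (q t) / (1 + t\<^sup>2))) (at_right 0)"
    by (simp only: Re_l)
  then show ?thesis
  proof (rule Lim_transform_eventually)
    show "\<forall>\<^sub>F \<rho> in at_right 0. Re (of_real \<rho> * integral {0..pi / 2} (?e \<rho>)) = \<rho> * zero_integral (x \<rho>) \<rho>"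
      unfolding eventually_at_filter by (intro always_eventually allI impI Re_e) simp
  qed
qed

lemma Re_exp_mult_cnj: "Re (exp (\<i> * of_real a) * cnj (of_real r * exp (\<i> * of_real b))) = r * cos (a - b)"
  by (simp add: Re_exp Im_exp cos_diff algebra_simps)

lemma tendsto_powr_at_right_0: "\<beta> > 0 \<Longrightarrow> ((\<lambda>\<rho>. c * \<rho> powr \<beta>) \<longlongrightarrow> 0) (at_right (0::real))"
  by real_asymp
lemma filterlim_powr_at_right_0: "\<beta> > 0 \<Longrightarrow> c > 0 \<Longrightarrow> filterlim (\<lambda>\<rho>. c * \<rho> powr (- \<beta>)) at_top (at_right (0::real))"
  by real_asymp

theorem corollary1p7:
  fixes \<alpha> \<eta> :: real and C \<psi> x :: "real \<Rightarrow> real"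
  assumes "\<alpha> > 0" and "\<eta> > 0"
    and "modulus_and_phase C \<psi>"
    and "\<And>\<rho>. \<rho> > 0 \<Longrightarrow> x \<rho> = \<eta> * \<rho> powr (- \<alpha>)"
  shows "(\<lambda>\<rho>. restricted_Good (x \<rho>) \<rho> - main_term C \<psi> \<alpha> \<eta> (x \<rho>) \<rho>)
           \<in> o[at_right 0](\<lambda>\<rho>. if \<alpha> > 3 then \<rho> powr (- 2) * x \<rho> powr (- 1 / 3) else 1 / \<rho>)"
proof -
  note \<alpha> = assms(1) and \<eta> = assms(2) and x = assms(4)
  have xpos: "x \<rho> > 0" if "\<rho> > 0" for \<rho> using that \<eta> by (simp add: x)
  have at_right: "(f \<longlongrightarrow> l) (at_right 0)" if "\<And>\<rho>. \<rho> > 0 \<Longrightarrow> f \<rho> = f' \<rho>" "(f' \<longlongrightarrow> l) (at_right 0)"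
    for f f' :: "real \<Rightarrow> 'a::topological_space" and l
    using that(2)
  proof (rule Lim_transform_eventually)
    show "\<forall>\<^sub>F \<rho> in at_right 0. f' \<rho> = f \<rho>"
      unfolding eventually_at_filter using that(1) by (intro always_eventually) simp
  qed
  have at_right_top: "filterlim f at_top (at_right 0)"
    if "\<And>\<rho>. \<rho> > 0 \<Longrightarrow> f \<rho> = f' \<rho>" "filterlim f' at_top (at_right 0)" for f f' :: "real \<Rightarrow> real"
    using that(2)
  proof (rule filterlim_mono_eventually[OF _ order_refl order_refl])
    show "\<forall>\<^sub>F \<rho> in at_right 0. f' \<rho> = f \<rho>"
      unfolding eventually_at_filter using that(1) by (intro always_eventually) simp
  qed
  consider "\<alpha> > 3" | "\<alpha> \<le> 3" by linarith
  then show ?thesis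
  proof cases
    case 1
    \<comment> \<open>The cube root of x, so that 1 / k is the width of the stationary region at
      \<theta> = pi.\<close>
    define k where "k \<rho> = (\<eta> * \<rho> powr (- \<alpha>)) powr (1 / 3)" for \<rho>
    have k: "k \<rho> > 0" "k \<rho> ^ 3 = x \<rho>" if "\<rho> > 0" for \<rho>
      using that \<eta> by (simp_all add: k_def x powr_power)
    have k_eq: "k \<rho> = \<eta> powr (1 / 3) * \<rho> powr (- (\<alpha> / 3))" if "\<rho> > 0" for \<rho>
      using that \<eta> by (simp add: k_def powr_mult powr_powr)
    have k_lim: "filterlim k at_top (at_right 0)"
      by (rule at_right_top[OF k_eq filterlim_powr_at_right_0]) (use \<alpha> \<eta> in auto)
    have g: "\<rho> powr (- 2) * x \<rho> powr (- 1 / 3) = 1 / (\<rho>\<^sup>2 * k \<rho>)" if "\<rho> > 0" for \<rho>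
    proof -
      have "x \<rho> powr (- 1 / 3) = inverse (k \<rho>)"
        using that by (simp add: k_def x powr_minus[symmetric])
      moreover have "\<rho> powr (- 2) = inverse (\<rho>\<^sup>2)"
        using that by (simp add: powr_minus)
      ultimately show ?thesis by (simp add: field_simps)
    qed
    have "(\<lambda>\<rho>. restricted_Good (x \<rho>) \<rho> - main_term C \<psi> \<alpha> \<eta> (x \<rho>) \<rho>)
        \<in> o[at_right 0](\<lambda>\<rho>. \<rho> powr (- 2) * x \<rho> powr (- 1 / 3))"
    proof (rule restricted_Good_smallo)
      show "\<rho> powr (- 2) * x \<rho> powr (- 1 / 3) > 0" if "\<rho> > 0" for \<rho>
        using xpos[OF that] that by simp
      \<comment> \<open>The bound 8 / (\<rho>^2 x) over the gauge 1 / (\<rho>^2 k) is 8 / k^2, as x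
        = k^3.\<close>
      show "((\<lambda>\<rho>. zero_integral (x \<rho>) \<rho> / (\<rho> powr (- 2) * x \<rho> powr (- 1 / 3))) \<longlongrightarrow> 0) (at_right 0)"
      proof (rule Lim_null_comparison)
        show "\<forall>\<^sub>F \<rho> in at_right 0. norm (zero_integral (x \<rho>) \<rho> / (\<rho> powr (- 2) * x \<rho> powr (- 1 / 3))) \<le> 8 / (k \<rho>)\<^sup>2"
          unfolding eventually_at_filter
        proof (intro always_eventually allI impI)
          fix \<rho> :: real assume "\<rho> \<in> {0<..}"
          then have \<rho>: "\<rho> > 0" by simp
          have "norm (zero_integral (x \<rho>) \<rho> / (\<rho> powr (- 2) * x \<rho> powr (- 1 / 3))) =
              \<bar>zero_integral (x \<rho>) \<rho>\<bar> * (\<rho>\<^sup>2 * k \<rho>)"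
            unfolding g[OF \<rho>] using k(1)[OF \<rho>] by (simp add: abs_mult)
          also have "\<dots> \<le> 8 / (\<rho>\<^sup>2 * x \<rho>) * (\<rho>\<^sup>2 * k \<rho>)"
            using k(1)[OF \<rho>] \<rho> xpos[OF \<rho>] by (intro mult_right_mono abs_zero_integral_le) auto
          also have "\<dots> = 8 / (k \<rho>)\<^sup>2"
            using k(1)[OF \<rho>] \<rho> by (simp add: k(2)[OF \<rho>, symmetric] field_simps power2_eq_square power3_eq_cube)
          finally show "norm (zero_integral (x \<rho>) \<rho> / (\<rho> powr (- 2) * x \<rho> powr (- 1 / 3))) \<le> 8 / (k \<rho>)\<^sup>2" .
        qed
        show "((\<lambda>\<rho>. 8 / (k \<rho>)\<^sup>2) \<longlongrightarrow> 0) (at_right 0)"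
          by (intro tendsto_divide_0[OF tendsto_const] filterlim_at_top_imp_at_infinity
              filterlim_pow_at_top k_lim) simp
      qed
      show "((\<lambda>\<rho>. pi_integral (x \<rho>) \<rho> 0 (pi / 2) / of_real (\<rho> powr (- 2) * x \<rho> powr (- 1 / 3))) \<longlongrightarrow>
          of_real (6 powr (1 / 3) * Gamma (1 / 3) / 3) * exp (\<i> * of_real (pi / 6))) (at_right 0)"
      proof (rule at_right)
        show "((\<lambda>\<rho>. of_real (\<rho>\<^sup>2 * k \<rho>) * pi_integral (k \<rho> ^ 3) \<rho> 0 (pi / 2)) \<longlongrightarrow>
            of_real (6 powr (1 / 3) * Gamma (1 / 3) / 3) * exp (\<i> * of_real (pi / 6))) (at_right 0)"
        proof (rule tendsto_pi_integral[OF k(1)])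
          show "filterlim k at_top (at_right 0)" by (rule k_lim)
          \<comment> \<open>Here \<alpha> > 3 is decisive: \<rho> k is a positive constant times
            \<rho> to the negative power 1 - \<alpha> / 3, so the stationary region is much narrower
            than \<rho>.\<close>
          show "filterlim (\<lambda>\<rho>. \<rho> * k \<rho>) at_top (at_right 0)"
          proof (rule at_right_top)
            show "\<rho> * k \<rho> = \<eta> powr (1 / 3) * \<rho> powr (- (\<alpha> / 3 - 1))" if "\<rho> > 0" for \<rho>
              using that by (simp add: k_eq mult.left_commute[of \<rho>] powr_mult_base)
          qed (rule filterlim_powr_at_right_0, use 1 \<eta> in auto)
        qed
        show "pi_integral (x \<rho>) \<rho> 0 (pi / 2) / of_real (\<rho> powr (- 2) * x \<rho> powr (- 1 / 3)) =
            of_real (\<rho>\<^sup>2 * k \<rho>) * pi_integral (k \<rho> ^ 3) \<rho> 0 (pi / 2)" if "\<rho> > 0" for \<rho>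
          unfolding g[OF that] k(2)[OF that] by simp
      qed
      show "main_term C \<psi> \<alpha> \<eta> (x \<rho>) \<rho> = \<rho> powr (- 2) * x \<rho> powr (- 1 / 3) / pi *
          (0 + Re (exp (\<i> * of_real (pi * x \<rho>)) *
            cnj (of_real (6 powr (1 / 3) * Gamma (1 / 3) / 3) * exp (\<i> * of_real (pi / 6)))))" if "\<rho> > 0" for \<rho>
      proof -
        have "(6 / x \<rho>) powr (1 / 3) = 6 powr (1 / 3) / k \<rho>"
          using that xpos[OF that] by (simp add: powr_divide k_def x)
        then show ?thesis
          unfolding Re_exp_mult_cnj g[OF that] using 1 by (simp add: main_term_def algebra_simps)
      qed
    qed
    with 1 show ?thesis by simp
  next
    case 2
    \<comment> \<open>All cases \<alpha> \<le> 3 share one gauge: \<open>Y\<close> is the limit of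
      \<rho> times the half at 0, and r exp(\<i> b) that of \<rho> times the half at pi. Division by
      pi turns pi / 2 into the 1/2 of the main term.\<close>
    define Y where "Y = (if \<alpha> > 1 then 0 else if \<alpha> = 1 then pi / 2 * exp (- 2 * \<eta>) else pi / 2)"
    define r where "r = (if \<alpha> = 3 then C \<eta> else pi / 2)"
    define b where "b = (if \<alpha> = 3 then pi * \<psi> \<eta> else 0)"
    have "(\<lambda>\<rho>. restricted_Good (x \<rho>) \<rho> - main_term C \<psi> \<alpha> \<eta> (x \<rho>) \<rho>) \<in> o[at_right 0](\<lambda>\<rho>. 1 / \<rho>)"
    proof (rule restricted_Good_smallo)
      show "((\<lambda>\<rho>. zero_integral (x \<rho>) \<rho> / (1 / \<rho>)) \<longlongrightarrow> Y) (at_right 0)"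
      proof (cases "\<alpha> > 1")
        case True
        \<comment> \<open>Van der Corput gives 8 / (\<rho> x) = (8 / \<eta>) \<rho>^(\<alpha> - 1),
          which vanishes as \<alpha> > 1.\<close>
        have "((\<lambda>\<rho>. zero_integral (x \<rho>) \<rho> / (1 / \<rho>)) \<longlongrightarrow> 0) (at_right 0)"
        proof (rule Lim_null_comparison)
          show "\<forall>\<^sub>F \<rho> in at_right 0. norm (zero_integral (x \<rho>) \<rho> / (1 / \<rho>)) \<le> 8 / \<eta> * \<rho> powr (\<alpha> - 1)"
            unfolding eventually_at_filter
          proof (intro always_eventually allI impI)
            fix \<rho> :: real assume "\<rho> \<in> {0<..}"
            then have \<rho>: "\<rho> > 0" by simp
            have "norm (zero_integral (x \<rho>) \<rho> / (1 / \<rho>)) = \<bar>zero_integral (x \<rho>) \<rho>\<bar> * \<rho>"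
              using \<rho> by (simp add: abs_mult)
            also have "\<dots> \<le> 8 / (\<rho>\<^sup>2 * x \<rho>) * \<rho>"
              using \<rho> xpos[OF \<rho>] by (intro mult_right_mono abs_zero_integral_le) auto
            also have "\<dots> = 8 / \<eta> * \<rho> powr (\<alpha> - 1)"
              using \<rho> \<eta> by (simp add: x powr_diff powr_minus field_simps power2_eq_square)
            finally show "norm (zero_integral (x \<rho>) \<rho> / (1 / \<rho>)) \<le> 8 / \<eta> * \<rho> powr (\<alpha> - 1)" .
          qed
          show "((\<lambda>\<rho>. 8 / \<eta> * \<rho> powr (\<alpha> - 1)) \<longlongrightarrow> 0) (at_right 0)"
            by (rule tendsto_powr_at_right_0) (use True in simp)
        qed
        with True show ?thesis by (simp add: Y_def)
      next
        case False
        \<comment> \<open>The limiting phase at scale \<rho> is c t. Since \<theta> + sin \<theta>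
          is about 2 \<theta>, the slope is 2 \<eta> for \<alpha> = 1; below 1 it is 0, and the same
          cosine integral yields pi / 2.\<close>
        define c where "c = (if \<alpha> = 1 then 2 * \<eta> else 0)"
        have lim: "((\<lambda>\<rho>. x \<rho> * (\<rho> * t + sin (\<rho> * t))) \<longlongrightarrow> c * t) (at_right 0)" for t
        proof (rule at_right)
          show "x \<rho> * (\<rho> * t + sin (\<rho> * t)) = \<eta> * \<rho> powr (1 - \<alpha>) * ((\<rho> * t + sin (\<rho> * t)) / \<rho>)" if "\<rho> > 0" for \<rho>
            using that by (simp add: x powr_diff powr_minus field_simps)
          have "((\<lambda>\<rho>. (\<rho> * t + sin (\<rho> * t)) / \<rho>) \<longlongrightarrow> 2 * t) (at_right 0)" by real_asymp
          moreover have "((\<lambda>\<rho>. \<eta> * \<rho> powr (1 - \<alpha>)) \<longlongrightarrow> c / 2) (at_right 0)"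
          proof (cases "\<alpha> = 1")
            case True
            show ?thesis by (rule at_right[of _ "\<lambda>_. \<eta>"]) (use True in \<open>auto simp: c_def\<close>)
          next
            case neq: False
            with False show ?thesis unfolding c_def by (auto intro!: tendsto_powr_at_right_0)
          qed
          ultimately have "((\<lambda>\<rho>. \<eta> * \<rho> powr (1 - \<alpha>) * ((\<rho> * t + sin (\<rho> * t)) / \<rho>)) \<longlongrightarrow> c / 2 * (2 * t)) (at_right 0)"
            by (intro tendsto_mult)
          then show "((\<lambda>\<rho>. \<eta> * \<rho> powr (1 - \<alpha>) * ((\<rho> * t + sin (\<rho> * t)) / \<rho>)) \<longlongrightarrow> c * t) (at_right 0)"
            by simp
        qed
        have "c \<ge> 0" using \<eta> by (simp add: c_def)
        from integral_unique[OF has_integral_cos_over_1_plus_square[OF this]]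
        have "integral {0..} (\<lambda>t. cos (c * t) / (1 + t\<^sup>2)) = Y"
          using False by (simp add: Y_def c_def split: if_splits)
        moreover have "((\<lambda>\<rho>. \<rho> * zero_integral (x \<rho>) \<rho>) \<longlongrightarrow> integral {0..} (\<lambda>t. cos (c * t) / (1 + t\<^sup>2))) (at_right 0)"
          by (intro tendsto_zero_integral continuous_intros lim)
        ultimately show ?thesis by (simp add: mult.commute)
      qed
      show "((\<lambda>\<rho>. pi_integral (x \<rho>) \<rho> 0 (pi / 2) / of_real (1 / \<rho>)) \<longlongrightarrow> of_real r * exp (\<i> * of_real b)) (at_right 0)"
      proof -
        \<comment> \<open>At \<theta> = pi the limiting phase is c t^3 / 6. For \<alpha> = 3 it
          gives the integral defining modulus and phase at \<eta>; for \<alpha> < 3 the phase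
          disappears and pi / 2 remains.\<close>
        define c where "c = (if \<alpha> = 3 then \<eta> else 0)"
        have lim: "((\<lambda>\<rho>. x \<rho> * (\<rho> * t - sin (\<rho> * t))) \<longlongrightarrow> c * t ^ 3 / 6) (at_right 0)" for t
        proof (rule at_right)
          show "x \<rho> * (\<rho> * t - sin (\<rho> * t)) = \<eta> * \<rho> powr (3 - \<alpha>) * ((\<rho> * t - sin (\<rho> * t)) / \<rho> ^ 3)" if "\<rho> > 0" for \<rho>
            using that by (simp add: x powr_diff powr_minus field_simps)
          have "((\<lambda>\<rho>. (\<rho> * t - sin (\<rho> * t)) / \<rho> ^ 3) \<longlongrightarrow> t ^ 3 / 6) (at_right 0)"
            by real_asymp (simp add: power3_eq_cube)
          moreover have "((\<lambda>\<rho>. \<eta> * \<rho> powr (3 - \<alpha>)) \<longlongrightarrow> c) (at_right 0)"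
          proof (cases "\<alpha> = 3")
            case True
            show ?thesis by (rule at_right[of _ "\<lambda>_. \<eta>"]) (use True in \<open>auto simp: c_def\<close>)
          next
            case neq: False
            with 2 show ?thesis unfolding c_def by (auto intro!: tendsto_powr_at_right_0)
          qed
          ultimately have "((\<lambda>\<rho>. \<eta> * \<rho> powr (3 - \<alpha>) * ((\<rho> * t - sin (\<rho> * t)) / \<rho> ^ 3)) \<longlongrightarrow> c * (t ^ 3 / 6)) (at_right 0)"
            by (intro tendsto_mult)
          then show "((\<lambda>\<rho>. \<eta> * \<rho> powr (3 - \<alpha>) * ((\<rho> * t - sin (\<rho> * t)) / \<rho> ^ 3)) \<longlongrightarrow> c * t ^ 3 / 6) (at_right 0)"
            by simp
        qed
        have "integral {0..} (\<lambda>t. exp (\<i> * of_real (c * t ^ 3 / 6)) / complex_of_real (1 + t\<^sup>2)) = of_real r * exp (\<i> * of_real b)"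
        proof (cases "\<alpha> = 3")
          case True
          then show ?thesis
            using assms(3) \<eta> unfolding modulus_and_phase_def c_def r_def b_def by simp
        next
          case False
          have "((\<lambda>t. complex_of_real (1 / (1 + t\<^sup>2))) has_integral of_real (pi / 2)) {0..}"
            by (rule has_integral_of_real[OF has_integral_inverse_1_plus_square])
          with False show ?thesis
            by (simp add: c_def r_def b_def integral_unique)
        qed
        moreover have "((\<lambda>\<rho>. of_real \<rho> * pi_integral (x \<rho>) \<rho> 0 (pi / 2)) \<longlongrightarrow>
            integral {0..} (\<lambda>t. exp (\<i> * of_real (c * t ^ 3 / 6)) / complex_of_real (1 + t\<^sup>2))) (at_right 0)"
          unfolding pi_integral_def
          by (intro tendsto_localised_integral[where P = "\<lambda>\<rho> u. x \<rho> * (u - sin u)"] continuous_intros lim)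
        ultimately show ?thesis by (simp add: mult.commute)
      qed
      show "main_term C \<psi> \<alpha> \<eta> (x \<rho>) \<rho> = 1 / \<rho> / pi * (Y + Re (exp (\<i> * of_real (pi * x \<rho>)) * cnj (of_real r * exp (\<i> * of_real b))))"
        if "\<rho> > 0" for \<rho>
        unfolding Re_exp_mult_cnj using 2 that
        by (auto simp: main_term_def Y_def r_def b_def field_simps)
    qed auto
    with 2 show ?thesis by simp
  qed
qed

end
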